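(* Let $k\ge 1$ be an integer. The space $M_k(\mathbb{C})$ of nondegenerate $2\times k\times(k+1)$ hypermatrices over $\mathbb{C}$ is connected, and has homotopy groups $$\pi_n(M_k(\mathbb{C}))\cong\begin{cases}\mathbb{Z} & \text{if } n=1,\\ \pi_n(GL_k(\mathbb{C}))\times\pi_n(GL_{k+1}(\mathbb{C})) & \text{if } n\ge 2.\end{cases}$$
   Context: A $2\times k\times(k+1)$ hypermatrix over a field $\mathbb{F}$ is an element of $\mathbb{F}^2\otimes\mathbb{F}^k\otimes\mathbb{F}^{k+1}$; it is written as a pair $(M_0,M_1)$ of $(k+1)\times k$ matrices over $\mathbb{F}$. It is degenerate (i.e. has zero hyperdeterminant) if there are nonzero vectors $x\in\overline{\mathbb{F}}^2$, $y\in\overline{\mathbb{F}}^k$, $z\in\overline{\mathbb{F}}^{k+1}$ at which the trilinear form $f(x,y,z)=\sum_{p,i,j}(M_p)_{ij}x_pz_iy_j$ and all its first partial derivatives vanish; for this format this is equivalent to the existence of nonzero $x\in\overline{\mathbb{F}}^2$, $y\in\overline{\mathbb{F}}^k$ with $(x_0M_0+x_1M_1)y=0$. Otherwise it is nondegenerate. $M_k(\mathbb{C})$ is the set of nondegenerate $2\times k\times(k+1)$ hypermatrices over $\mathbb{C}$, with the subspace topology from $\mathbb{C}^{2k(k+1)}$ (Euclidean topology). *)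

theory Defs
  imports "HOL-Analysis.Analysis" "HOL-Algebra.Elementary_Groups"
begin

section \<open>Hypermatrices\<close>

text \<open>
  With \<open>CARD('m) = CARD('k) + 1\<close>, the type \<open>complex^'k^'m^2\<close> is the space of
  \<open>2 \<times> k \<times> (k+1)\<close> hypermatrices: \<open>A $ p\<close>, for \<open>p :: 2\<close>, are the two
  \<open>(k+1) \<times> k\<close> slices.
\<close>

definition trilinear_form ::
    "complex^'k^'m^2 \<Rightarrow> complex^2 \<Rightarrow> complex^'k \<Rightarrow> complex^'m \<Rightarrow> complex" where
  "trilinear_form A x y z =
     (\<Sum>p\<in>UNIV. \<Sum>i\<in>UNIV. \<Sum>j\<in>UNIV. A $ p $ i $ j * x $ p * z $ i * y $ j)"

text \<open>
  No passage to an algebraic closure is needed over the complex numbers. The last three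
  conjuncts are the vanishing of the first partial derivatives in the coordinates of
  \<open>x\<close>, \<open>y\<close> and \<open>z\<close>.
\<close>

definition degenerate :: "complex^'k^'m^2 \<Rightarrow> bool" where
  "degenerate A \<longleftrightarrow> (\<exists>x y z. x \<noteq> 0 \<and> y \<noteq> 0 \<and> z \<noteq> 0 \<and>
     trilinear_form A x y z = 0 \<and>
     (\<forall>p. ((\<lambda>t. trilinear_form A (x + t *s axis p 1) y z) has_field_derivative 0) (at 0)) \<and>
     (\<forall>j. ((\<lambda>t. trilinear_form A x (y + t *s axis j 1) z) has_field_derivative 0) (at 0)) \<and>
     (\<forall>i. ((\<lambda>t. trilinear_form A x y (z + t *s axis i 1)) has_field_derivative 0) (at 0)))"

definition nondegenerate_hypermatrices :: "(complex^'k^'m^2) set" where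
  "nondegenerate_hypermatrices = {A. \<not> degenerate A}"

definition general_linear :: "(complex^'k^'k) set" where
  "general_linear = {A. invertible A}"


section \<open>Homotopy groups\<close>

definition cube :: "nat \<Rightarrow> (nat \<Rightarrow> real) topology" where
  "cube n = product_topology (\<lambda>_. top_of_set {0..1}) {..<n}"

definition cube_boundary :: "nat \<Rightarrow> (nat \<Rightarrow> real) set" where
  "cube_boundary n = {t \<in> topspace (cube n). \<exists>i<n. t i = 0 \<or> t i = 1}"

definition spheroid :: "nat \<Rightarrow> 'a topology \<Rightarrow> 'a \<Rightarrow> ((nat \<Rightarrow> real) \<Rightarrow> 'a) \<Rightarrow> bool" where
  "spheroid n X a f \<longleftrightarrow> continuous_map (cube n) X f \<and> (\<forall>t\<in>cube_boundary n. f t = a)"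

definition homotopic_spheroids ::
    "nat \<Rightarrow> 'a topology \<Rightarrow> 'a \<Rightarrow> ((nat \<Rightarrow> real) \<Rightarrow> 'a) \<Rightarrow> ((nat \<Rightarrow> real) \<Rightarrow> 'a) \<Rightarrow> bool" where
  "homotopic_spheroids n X a = homotopic_with (\<lambda>h. \<forall>t\<in>cube_boundary n. h t = a) (cube n) X"

definition spheroid_concat ::
    "((nat \<Rightarrow> real) \<Rightarrow> 'a) \<Rightarrow> ((nat \<Rightarrow> real) \<Rightarrow> 'a) \<Rightarrow> (nat \<Rightarrow> real) \<Rightarrow> 'a" where
  "spheroid_concat f g t =
     (if t 0 \<le> 1/2 then f (t(0 := 2 * t 0)) else g (t(0 := 2 * t 0 - 1)))"

text \<open>
  This is meaningful for \<open>n \<ge> 1\<close> only, as the product concatenates along the coordinate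
  with index \<open>0\<close>. Spheroids are arbitrary outside the cube, but those that agree on the
  cube are homotopic, so the homotopy classes are the usual ones. The product of the
  classes of \<open>f\<close> and \<open>g\<close> is the class of \<open>spheroid_concat f g\<close>.
\<close>

definition homotopy_group ::
    "nat \<Rightarrow> 'a topology \<Rightarrow> 'a \<Rightarrow> ((nat \<Rightarrow> real) \<Rightarrow> 'a) set monoid" where
  "homotopy_group n X a =
     \<lparr>carrier = Collect (spheroid n X a) // {(f, g). homotopic_spheroids n X a f g},
      monoid.mult = (\<lambda>P Q. {h. \<exists>f\<in>P. \<exists>g\<in>Q. homotopic_spheroids n X a (spheroid_concat f g) h}),
      one = {h. homotopic_spheroids n X a (\<lambda>_. a) h}\<rparr>"

end

theory Submission
  imports Defs "HOL-Complex_Analysis.Riemann_Mapping"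
    "HOL-Computational_Algebra.Fundamental_Theorem_Algebra"
begin

text \<open>
  The group \<open>GL\<^sub>k \<times> GL\<^sub>k\<^sub>+\<^sub>1\<close> acts on the pairs \<open>(M\<^sub>1, M\<^sub>2)\<close> of \<open>(k + 1) \<times> k\<close> matrices by
  \<open>(A, B) \<cdot> M\<^sub>p = B M\<^sub>p A\<close>. A pair is nondegenerate if and only if no matrix
  \<open>x\<^sub>1 M\<^sub>1 + x\<^sub>2 M\<^sub>2\<close> with \<open>x \<noteq> 0\<close> has a kernel (\<open>nondegenerate_iff\<close>), and Kronecker's normal
  form says that all such pairs lie in the orbit of one block \<open>L\<close>
  (\<open>nondegenerate_equiv_block\<close>), whose stabiliser consists of the pairs
  \<open>(c\<inverse> I, c I)\<close> (\<open>block_stabiliser\<close>). The character \<open>(A, B) \<mapsto> det A det B\<close> takes the value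
  \<open>c\<^sup>-\<^sup>k c\<^sup>k\<^sup>+\<^sup>1 = c\<close> on this element, so it restricts to an isomorphism from the stabiliser to
  \<open>\<complex>\<^sup>*\<close>. For a nondegenerate \<open>a\<close> the map \<open>(A, B) \<mapsto> ((A, B) \<cdot> a, det A det B)\<close> is therefore a
  continuous bijection from \<open>GL\<^sub>k \<times> GL\<^sub>k\<^sub>+\<^sub>1\<close> to \<open>M\<^sub>k \<times> \<complex>\<^sup>*\<close>. Both live in complex vector
  spaces of dimension \<open>k\<^sup>2 + (k + 1)\<^sup>2 = 2 k (k + 1) + 1\<close>, so invariance of domain makes it a
  homeomorphism (\<open>orbit_map_homeomorphism\<close>). The coprimality of \<open>k\<close> and \<open>k + 1\<close> thus replaces
  the long exact sequence of the fibration \<open>GL\<^sub>k \<times> GL\<^sub>k\<^sub>+\<^sub>1 \<rightarrow> M\<^sub>k\<close> by a product.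

  For \<open>n \<ge> 2\<close> the result follows at once, since homotopy groups turn products into products
  and \<open>\<pi>\<^sub>n(\<complex>\<^sup>*) = 0\<close>: a map from the cube to \<open>\<complex>\<^sup>*\<close> has a logarithm, which is constant on the
  connected boundary of the cube and can be contracted linearly
  (\<open>trivial_spheroids_punctured_plane\<close>).

  For \<open>n = 1\<close> the slice \<open>det A det B = 1\<close> of the homeomorphism identifies \<open>M\<^sub>k\<close> with the pairs
  of matrices of reciprocal determinants. Splitting off the determinant of \<open>A\<close> yields
  \<open>M\<^sub>k \<cong> \<complex>\<^sup>* \<times> (SL\<^sub>k \<times> SL\<^sub>k\<^sub>+\<^sub>1)\<close> (\<open>nondegenerate_decomposition\<close>). The special linear groups are
  simply connected (\<open>simply_connected_special_linear\<close>), so \<open>M\<^sub>k\<close> is connected and its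
  fundamental group is that of \<open>\<complex>\<^sup>*\<close>, which the winding number identifies with \<open>\<int>\<close>.

  Simple connectedness of \<open>SL\<^sub>n\<close> is proved by Gaussian elimination over a ring of functions.
  A loop in \<open>SL\<^sub>n\<close> is homotopic to a differentiable one. Its elimination multiplies it by
  transvections whose entries are differentiable loops in \<open>\<complex>\<close>, and such a loop of transvections
  contracts by scaling its entries to zero. Elimination needs a pivot that vanishes nowhere on
  the loop. A generic constant combination of the entries of a column provides one, because
  a differentiable curve does not fill the plane.
\<close>

section \<open>Degenerate pencils of matrices\<close>

definition pencil :: "complex^'k^'m^2 \<Rightarrow> complex^2 \<Rightarrow> complex^'k^'m" where
  "pencil A x = (\<chi> i j. x $ 1 * A $ 1 $ i $ j + x $ 2 * A $ 2 $ i $ j)"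

lemma pencil_mult_vec: "pencil A x *v y = x $ 1 *s (A $ 1 *v y) + x $ 2 *s (A $ 2 *v y)"
  by (simp add: pencil_def matrix_vector_mult_def vec_eq_iff sum_distrib_left
      sum.distrib[symmetric] algebra_simps)

lemma trilinear_form_eq: "trilinear_form A x y z = (\<Sum>i\<in>UNIV. z $ i * (pencil A x *v y) $ i)"
  unfolding trilinear_form_def pencil_def matrix_vector_mult_def
  by (simp add: sum_2 sum.distrib[symmetric] sum_distrib_left algebra_simps)

lemma trilinear_form_linear:
  "trilinear_form A (x + t *s x') y z = trilinear_form A x y z + t * trilinear_form A x' y z"
  "trilinear_form A x (y + t *s y') z = trilinear_form A x y z + t * trilinear_form A x y' z"
  "trilinear_form A x y (z + t *s z') = trilinear_form A x y z + t * trilinear_form A x y z'"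
  unfolding trilinear_form_def
  by (simp_all add: sum.distrib[symmetric] sum_distrib_left algebra_simps)

lemma affine_has_derivative_0_iff:
  "((\<lambda>t::complex. c + t * d) has_field_derivative 0) (at 0) \<longleftrightarrow> d = 0"
proof -
  have "((\<lambda>t::complex. c + t * d) has_field_derivative d) (at 0)"
    by (auto intro!: derivative_eq_intros)
  then show ?thesis
    using DERIV_unique by metis
qed

text \<open>
  Two systems of linear equations below have more unknowns than equations; their nonzero
  solutions come from this count of real dimensions.
\<close>

lemma linear_to_smaller_dim_not_injective:
  fixes f :: "'a::euclidean_space \<Rightarrow> 'b::euclidean_space"
  assumes "linear f" "DIM('b) < DIM('a)"
  obtains x where "x \<noteq> 0" "f x = 0"
proof -
  have "\<not> inj f"
  proof
    assume "inj f"
    then have "dim (range f) = DIM('a)"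
      using dim_image_eq[OF assms(1), of UNIV] by simp
    then show False
      using dim_subset_UNIV[of "range f"] assms(2) by simp
  qed
  then show ?thesis
    using linear_injective_0[OF assms(1)] that by blast
qed

lemma wide_matrix_has_kernel:
  fixes T :: "complex^'m^'k"
  assumes "CARD('k) < CARD('m)"
  obtains z where "z \<noteq> 0" "T *v z = 0"
proof -
  have "linear ((*v) T)"
    by (rule linearI) (simp_all add: vec_eq_iff matrix_vector_mult_def sum.distrib[symmetric] algebra_simps scaleR_sum_right)
  moreover have "DIM(complex^'k) < DIM(complex^'m)"
    using assms by simp
  ultimately show ?thesis
    using linear_to_smaller_dim_not_injective that by blast
qed

lemma sum_mult_matrix_vec:
  fixes N :: "complex^'k^'m"
  shows "(\<Sum>i\<in>UNIV. z $ i * (N *v y) $ i) = (\<Sum>j\<in>UNIV. (z v* N) $ j * y $ j)"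
  unfolding matrix_vector_mult_def vector_matrix_mult_def
  by (simp add: sum_distrib_left sum_distrib_right, subst sum.swap, simp add: algebra_simps)

text \<open>
  The partial derivatives in \<open>z\<close> vanish if and only if \<open>y\<close> is in the kernel of \<open>pencil A x\<close>.
  Conversely, given such \<open>x\<close> and \<open>y\<close>, the remaining derivatives vanish at every
  \<open>z\<close> that is orthogonal to the image of \<open>pencil A x\<close> and to \<open>A\<^sub>1 y\<close> and \<open>A\<^sub>2 y\<close>. The last two
  vectors are linearly dependent and the image has dimension at most \<open>k - 1\<close>, so \<open>z\<close> is
  subject to at most \<open>k\<close> conditions in dimension \<open>k + 1\<close>.
\<close>

lemma degenerate_iff:
  fixes A :: "complex^'k^'m^2"
  assumes card: "CARD('m) = CARD('k) + 1"
  shows "degenerate A \<longleftrightarrow> (\<exists>x y. x \<noteq> 0 \<and> y \<noteq> 0 \<and> pencil A x *v y = 0)"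
proof
  assume "degenerate A"
  then obtain x y z where xyz: "x \<noteq> 0" "y \<noteq> 0"
    and "\<forall>i. ((\<lambda>t. trilinear_form A x y (z + t *s axis i 1)) has_field_derivative 0) (at 0)"
    unfolding degenerate_def by blast
  then have "\<forall>i. trilinear_form A x y (axis i 1) = 0"
    by (simp add: trilinear_form_linear affine_has_derivative_0_iff)
  then have "pencil A x *v y = 0"
    by (simp add: trilinear_form_eq axis_def vec_eq_iff if_distrib[of "\<lambda>u. u * _"] cong: if_cong)
  with xyz show "\<exists>x y. x \<noteq> 0 \<and> y \<noteq> 0 \<and> pencil A x *v y = 0"
    by blast
next
  assume "\<exists>x y. x \<noteq> 0 \<and> y \<noteq> 0 \<and> pencil A x *v y = 0"
  then obtain x y where x: "x \<noteq> 0" and y: "y \<noteq> 0" and xy: "pencil A x *v y = 0"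
    by blast
  obtain p q :: 2 where pq: "(p = 1 \<and> q = 2) \<or> (p = 2 \<and> q = 1)" and xp: "x $ p \<noteq> 0"
    using x by (auto simp: vec_eq_iff forall_2)
  obtain j0 where j0: "y $ j0 \<noteq> 0"
    using y by (auto simp: vec_eq_iff)
  \<comment> \<open>As \<open>pencil A x\<close> annihilates \<open>y\<close>, changing it to the value \<open>w\<close> at \<open>y\<close> by a matrix of
    rank one gives \<open>N\<close>, whose image contains both \<open>w\<close> and the image of \<open>pencil A x\<close>.\<close>
  define w where "w = A $ q *v y"
  define N :: "complex^'k^'m" where
    "N = (\<chi> i j. pencil A x $ i $ j + (if j = j0 then w $ i / y $ j0 else 0))"
  obtain z where z: "z \<noteq> 0" and "transpose N *v z = 0"
    using wide_matrix_has_kernel[of "transpose N"] card by auto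
  then have zN: "z v* N = 0"
    by simp
  have N_mult: "N *v v = pencil A x *v v + (v $ j0 / y $ j0) *s w" for v
    by (simp add: N_def matrix_vector_mult_def vec_eq_iff algebra_simps sum.distrib
        if_distrib[of "\<lambda>u. _ * u"] cong: if_cong)
  have zNv: "(\<Sum>i\<in>UNIV. z $ i * (N *v v) $ i) = 0" for v
    by (simp add: sum_mult_matrix_vec zN)
  have zw: "(\<Sum>i\<in>UNIV. z $ i * w $ i) = 0"
    using zNv[of y] by (simp add: N_mult xy j0)
  have 1: "trilinear_form A x y' z = 0" for y'
  proof -
    have "trilinear_form A x y' z + (y' $ j0 / y $ j0) * (\<Sum>i\<in>UNIV. z $ i * w $ i) = 0"
      using zNv[of y'] 
      by (simp add: N_mult trilinear_form_eq sum_distrib_left sum.distrib[symmetric] algebra_simps)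
    then show ?thesis
      by (simp add: zw)
  qed
  have dep: "A $ p *v y = (- (x $ q / x $ p)) *s w"
  proof -
    have "x $ p *s (A $ p *v y) + x $ q *s w = 0"
      using xy pq by (auto simp: pencil_mult_vec w_def add.commute)
    then show ?thesis
      using xp by (simp add: vec_eq_iff field_simps eq_neg_iff_add_eq_0)
  qed
  have 2: "trilinear_form A (axis r 1) y z = 0" for r
  proof -
    have "trilinear_form A (axis r 1) y z = (\<Sum>i\<in>UNIV. z $ i * (A $ r *v y) $ i)"
      using exhaust_2[of r] by (auto simp: trilinear_form_eq pencil_mult_vec axis_def)
    also have "\<dots> = 0"
    proof (cases "r = q")
      case True
      then show ?thesis using zw by (simp add: w_def)
    next
      case False
      then have "r = p" using pq exhaust_2[of r] by auto
      then have "(\<Sum>i\<in>UNIV. z $ i * (A $ r *v y) $ i) = - (x $ q / x $ p) * (\<Sum>i\<in>UNIV. z $ i * w $ i)"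
        by (simp add: dep sum_distrib_left algebra_simps)
      then show ?thesis by (simp add: zw)
    qed
    finally show ?thesis .
  qed
  have 3: "trilinear_form A x y z' = 0" for z'
    by (simp add: trilinear_form_eq xy)
  show "degenerate A"
    unfolding degenerate_def
    by (intro exI[of _ x] exI[of _ y] exI[of _ z])
      (simp add: x y z trilinear_form_linear affine_has_derivative_0_iff 1 2 3)
qed

lemma nondegenerate_iff:
  fixes A :: "complex^'k^'m^2"
  assumes "CARD('m) = CARD('k) + 1"
  shows "A \<in> nondegenerate_hypermatrices \<longleftrightarrow>
    (\<forall>x y. x \<noteq> 0 \<longrightarrow> pencil A x *v y = 0 \<longrightarrow> y = 0)"
  using degenerate_iff[OF assms] by (auto simp: nondegenerate_hypermatrices_def)

definition act :: "complex^'m^'m \<Rightarrow> complex^'k^'m^2 \<Rightarrow> complex^'k^'k \<Rightarrow> complex^'k^'m^2" where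
  "act B M A = (\<chi> p. B ** M $ p ** A)"

lemma act_act: "act B (act B' M A') A = act (B ** B') M (A' ** A)"
  by (simp add: act_def vec_eq_iff matrix_mul_assoc)

lemma act_one [simp]: "act (mat 1) M (mat 1) = M"
  by (simp add: act_def vec_eq_iff)

lemma pencil_act: "pencil (act B M A) x *v y = B *v (pencil M x *v (A *v y))"
  by (simp add: pencil_mult_vec act_def matrix_vector_mul_assoc[symmetric] vec.add vec.scale)

lemma invertible_mult_vec_eq_0_iff:
  fixes A :: "complex^'n^'n"
  assumes "invertible A"
  shows "A *v x = 0 \<longleftrightarrow> x = 0"
  using assms matrix_left_invertible_ker[of A] invertible_left_inverse[of A] by auto

lemma act_nondegenerate:
  fixes M :: "complex^'k^'m^2"
  assumes "CARD('m) = CARD('k) + 1" "invertible A" "invertible B"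
    and "M \<in> nondegenerate_hypermatrices"
  shows "act B M A \<in> nondegenerate_hypermatrices"
  using assms unfolding nondegenerate_iff[OF assms(1)] pencil_act
  by (metis invertible_mult_vec_eq_0_iff)

text \<open>
  Take a polynomial \<open>p \<noteq> 0\<close> of least degree with \<open>p(f) v = 0\<close>; there is one because the
  iterates of \<open>v\<close> are linearly dependent or not distinct. With a root \<open>c\<close> of \<open>p\<close> and
  \<open>p = (X - c) q\<close>, the vector \<open>q(f) v\<close> is nonzero by minimality and \<open>f - c\<close> annihilates it.
\<close>

lemma eigenvector_in_invariant_subspace:
  fixes f :: "complex^'n \<Rightarrow> complex^'n"
  assumes lin: "Vector_Spaces.linear (*s) (*s) f" and X: "vec.subspace X"
    and inv: "\<And>v. v \<in> X \<Longrightarrow> f v \<in> X" and v: "v \<in> X" "v \<noteq> 0"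
  obtains y c where "y \<in> X" "y \<noteq> 0" "f y = c *s y"
proof -
  interpret f: Vector_Spaces.linear "(*s)" "(*s)" f by (rule lin)
  define ev where "ev p w = (\<Sum>i\<le>degree p. coeff p i *s (f ^^ i) w)" for p :: "complex poly" and w
  have iter: "(f ^^ i) w \<in> X" if "w \<in> X" for i w
    using that by (induction i) (auto intro: inv)
  have evX: "ev p w \<in> X" if "w \<in> X" for p w
    unfolding ev_def by (intro vec.subspace_sum X vec.subspace_scale iter that)
  have ev_bound: "ev p w = (\<Sum>i\<le>N. coeff p i *s (f ^^ i) w)" if "degree p \<le> N" for p w N
    unfolding ev_def using that
    by (intro sum.mono_neutral_left) (auto simp: coeff_eq_0)
  have ev_linear_factor: "ev ([:-c, 1:] * q) w = f (ev q w) - c *s ev q w" for c q w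
  proof -
    define N where "N = degree q"
    have deg: "degree ([:-c, 1:] * q) \<le> Suc N"
      using degree_mult_le[of "[:-c, 1:]" q] by (simp add: N_def)
    have co: "coeff ([:-c, 1:] * q) i = (case i of 0 \<Rightarrow> 0 | Suc j \<Rightarrow> coeff q j) - c * coeff q i" for i
      by (simp add: coeff_pCons split: nat.split)
    have "ev ([:-c, 1:] * q) w
        = (\<Sum>i\<le>Suc N. (case i of 0 \<Rightarrow> 0 | Suc j \<Rightarrow> coeff q j) *s (f ^^ i) w) - (\<Sum>i\<le>Suc N. c *s (coeff q i *s (f ^^ i) w))"
      by (simp only: ev_bound[OF deg] co vec.scale_left_diff_distrib sum_subtractf vec.scale_scale)
    also have "(\<Sum>i\<le>Suc N. (case i of 0 \<Rightarrow> 0 | Suc j \<Rightarrow> coeff q j) *s (f ^^ i) w)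
        = (\<Sum>i\<le>N. coeff q i *s (f ^^ Suc i) w)"
      by (subst sum.atMost_Suc_shift) simp
    also have "\<dots> = f (ev q w)"
      by (simp add: ev_def N_def f.sum f.scale)
    also have "(\<Sum>i\<le>Suc N. c *s (coeff q i *s (f ^^ i) w)) = c *s ev q w"
      by (simp add: ev_bound[of q "Suc N"] N_def vec.scale_sum_right)
    finally show ?thesis .
  qed
  have "\<exists>p. p \<noteq> 0 \<and> ev p v = 0"
  proof -
    define N where "N = CARD('n)"
    show ?thesis
    proof (cases "inj_on (\<lambda>i. (f ^^ i) v) {..N}")
      case True
      define S where "S = (\<lambda>i. (f ^^ i) v) ` {..N}"
      have "card S = Suc N"
        unfolding S_def by (simp add: card_image True)
      then have "vec.dependent S"
        using vec.independent_card_le_dim[of S UNIV] by (auto simp: N_def card_cart_basis)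
      then obtain u s where us: "(\<Sum>x\<in>S. u x *s x) = 0" "s \<in> S" "u s \<noteq> 0"
        using vec.dependent_finite[of S] by (auto simp: S_def)
      define p where "p = Poly (map (\<lambda>i. u ((f ^^ i) v)) [0..<Suc N])"
      have co: "coeff p i = (if i \<le> N then u ((f ^^ i) v) else 0)" for i
        unfolding p_def coeff_Poly_eq nth_default_def by (auto simp del: upt_Suc)
      have "degree p \<le> N"
        by (rule degree_le) (simp add: co)
      then have "ev p v = (\<Sum>i\<le>N. u ((f ^^ i) v) *s (f ^^ i) v)"
        by (simp add: ev_bound co)
      also have "\<dots> = (\<Sum>x\<in>S. u x *s x)"
        unfolding S_def by (simp add: sum.reindex[OF True])
      finally have "ev p v = 0" using us by simp
      moreover have "p \<noteq> 0"
      proof -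
        obtain i where i: "i \<le> N" "s = (f ^^ i) v" using us(2) by (auto simp: S_def)
        then have "coeff p i \<noteq> 0" using us(3) by (simp add: co)
        then show ?thesis by auto
      qed
      ultimately show ?thesis by blast
    next
      case False
      then obtain i j where ij: "i < j" "(f ^^ i) v = (f ^^ j) v"
        unfolding inj_on_def by (metis linorder_neqE_nat)
      define p where "p = monom (1::complex) j - monom 1 i"
      have co: "coeff p l = (if l = j then 1 else 0) - (if l = i then 1 else 0)" for l
        by (simp add: p_def)
      have "degree p \<le> j"
        by (rule degree_le) (use ij in \<open>simp add: co\<close>)
      then have "ev p v = (\<Sum>l\<le>j. ((if l = j then 1 else 0) - (if l = i then 1 else 0)) *s (f ^^ l) v)"
        by (simp add: ev_bound co)
      also have "\<dots> = (\<Sum>l\<le>j. (if l = j then (f ^^ l) v else 0)) - (\<Sum>l\<le>j. (if l = i then (f ^^ l) v else 0))"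
        unfolding sum_subtractf[symmetric] by (intro sum.cong) auto
      also have "\<dots> = 0"
        using ij by simp
      finally have "ev p v = 0" .
      moreover have "p \<noteq> 0"
        using co[of j] ij(1) by auto
      ultimately show ?thesis by blast
    qed
  qed
  then obtain p where p: "p \<noteq> 0" "ev p v = 0"
    and min: "\<And>q. q \<noteq> 0 \<Longrightarrow> ev q v = 0 \<Longrightarrow> degree p \<le> degree q"
    using ex_has_least_nat[of "\<lambda>p. p \<noteq> 0 \<and> ev p v = 0" _ degree] by metis
  have "degree p \<noteq> 0"
  proof
    assume "degree p = 0"
    then obtain c where "p = [:c:]" by (metis degree_eq_zeroE)
    then show False using p v by (auto simp: ev_def)
  qed
  then obtain c where "poly p c = 0"
    using fundamental_theorem_of_algebra[of p] by (auto simp: constant_degree)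
  then obtain q where q: "p = [:-c, 1:] * q"
    using poly_eq_0_iff_dvd by (metis dvdE)
  then have q0: "q \<noteq> 0" using p by auto
  then have "degree p = Suc (degree q)"
    unfolding q by (subst degree_mult_eq) auto
  then have "ev q v \<noteq> 0" using min[OF q0] by auto
  moreover have "f (ev q v) = c *s ev q v"
    using p(2) unfolding q ev_linear_factor by simp
  ultimately show ?thesis using that evX[OF v(1)] by blast
qed

section \<open>The Kronecker normal form\<close>

text \<open>
  The row and column indices of a hypermatrix are arbitrary finite types. The bijections \<open>\<iota>\<close> and
  \<open>\<kappa>\<close> number the columns by \<open>0, \<dots>, k - 1\<close> and the rows by \<open>0, \<dots>, k\<close>, so that one can speak
  of the next row.
\<close>

locale kronecker_indexing =
  fixes \<iota> :: "'k::finite \<Rightarrow> nat" and \<kappa> :: "'m::finite \<Rightarrow> nat"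
  assumes bij_\<iota>: "bij_betw \<iota> UNIV {..<CARD('k)}"
    and bij_\<kappa>: "bij_betw \<kappa> UNIV {..CARD('k)}"
begin

definition col_index :: "nat \<Rightarrow> 'k" where "col_index = inv_into UNIV \<iota>"

definition row_index :: "nat \<Rightarrow> 'm" where "row_index = inv_into UNIV \<kappa>"

lemma \<iota>_col_index [simp]: "n < CARD('k) \<Longrightarrow> \<iota> (col_index n) = n"
  unfolding col_index_def using bij_betw_inv_into_right[OF bij_\<iota>] by auto

lemma col_index_\<iota> [simp]: "col_index (\<iota> j) = j"
  unfolding col_index_def using bij_betw_inv_into_left[OF bij_\<iota>] by auto

lemma \<kappa>_row_index [simp]: "n \<le> CARD('k) \<Longrightarrow> \<kappa> (row_index n) = n"
  unfolding row_index_def using bij_betw_inv_into_right[OF bij_\<kappa>] by auto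

lemma row_index_\<kappa> [simp]: "row_index (\<kappa> i) = i"
  unfolding row_index_def using bij_betw_inv_into_left[OF bij_\<kappa>] by auto

lemma \<iota>_less [simp]: "\<iota> j < CARD('k)"
  using bij_\<iota> by (auto simp: bij_betw_def)

lemma \<kappa>_le [simp]: "\<kappa> i \<le> CARD('k)"
  using bij_\<kappa> by (auto simp: bij_betw_def)

lemma \<kappa>_less: "\<kappa> i \<noteq> CARD('k) \<Longrightarrow> \<kappa> i < CARD('k)"
  by (rule le_neq_implies_less[OF \<kappa>_le])

lemma \<kappa>_inject [simp]: "\<kappa> i = \<kappa> j \<longleftrightarrow> i = j"
  by (metis row_index_\<kappa>)

lemma \<iota>_inject [simp]: "\<iota> i = \<iota> j \<longleftrightarrow> i = j"
  by (metis col_index_\<iota>)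

lemma \<iota>_eq_iff: "n < CARD('k) \<Longrightarrow> n = \<iota> j \<longleftrightarrow> j = col_index n"
  by auto

lemma \<kappa>_eq_iff: "n \<le> CARD('k) \<Longrightarrow> \<kappa> i = n \<longleftrightarrow> i = row_index n"
  by auto

lemma card_eq: "CARD('m) = CARD('k) + 1"
  using bij_betw_same_card[OF bij_\<kappa>] by simp

text \<open>
  In this numbering the slices are the matrices of \<open>e\<^sub>j \<mapsto> e\<^sub>j\<^sub>+\<^sub>1\<close> and \<open>e\<^sub>j \<mapsto> - e\<^sub>j\<close>. The sign is
  the one that comes out of the syzygies below.
\<close>

definition block :: "complex^'k^'m^2" where
  "block = (\<chi> p i j. if p = 1 then (if \<kappa> i = Suc (\<iota> j) then 1 else 0)
     else (if \<kappa> i = \<iota> j then -1 else 0))"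

lemma block_1: "block $ 1 $ i $ j = (if \<kappa> i = Suc (\<iota> j) then 1 else 0)"
  and block_2: "block $ 2 $ i $ j = (if \<kappa> i = \<iota> j then -1 else 0)"
  by (simp_all add: block_def)

lemma sum_block_1:
  "(\<Sum>j\<in>UNIV. block $ 1 $ i $ j * f j) = (if \<kappa> i = 0 then 0 else f (col_index (\<kappa> i - 1)))"
proof (cases "\<kappa> i")
  case 0
  then show ?thesis by (simp add: block_1)
next
  case (Suc n)
  then have "n < CARD('k)" by (metis \<kappa>_le Suc_le_eq)
  then have "n = \<iota> j \<longleftrightarrow> j = col_index n" for j by auto
  then show ?thesis using Suc by (simp add: block_1 if_distrib[of "\<lambda>u. u * _"] cong: if_cong)
qed

lemma sum_block_2:
  "(\<Sum>j\<in>UNIV. block $ 2 $ i $ j * f j) = (if \<kappa> i = CARD('k) then 0 else - f (col_index (\<kappa> i)))"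
proof (cases "\<kappa> i = CARD('k)")
  case True
  then have "\<kappa> i \<noteq> \<iota> j" for j by (metis \<iota>_less less_irrefl)
  then show ?thesis using True by (simp add: block_2)
next
  case False
  then have "\<kappa> i < CARD('k)" by (rule \<kappa>_less)
  then have "\<kappa> i = \<iota> j \<longleftrightarrow> j = col_index (\<kappa> i)" for j by (rule \<iota>_eq_iff)
  then show ?thesis using False by (simp add: block_2 if_distrib[of "\<lambda>u. u * _"] cong: if_cong)
qed

lemma mult_block_1: "(C ** block $ 1) $ i $ j = C $ i $ row_index (Suc (\<iota> j))"
  using \<iota>_less[of j]
  by (simp add: matrix_matrix_mult_def block_1 \<kappa>_eq_iff if_distrib[of "\<lambda>u. _ * u"] Suc_leI cong: if_cong)

lemma mult_block_2: "(C ** block $ 2) $ i $ j = - C $ i $ row_index (\<iota> j)"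
  using \<iota>_less[of j]
  by (simp add: matrix_matrix_mult_def block_2 \<kappa>_eq_iff if_distrib[of "\<lambda>u. _ * u"] less_imp_le cong: if_cong)

lemma block_mult_1:
  "(block $ 1 ** D) $ i $ l = (if \<kappa> i = 0 then 0 else D $ col_index (\<kappa> i - 1) $ l)"
  by (simp add: matrix_matrix_mult_def sum_block_1)

lemma block_mult_2:
  "(block $ 2 ** D) $ i $ l = (if \<kappa> i = CARD('k) then 0 else - D $ col_index (\<kappa> i) $ l)"
  by (simp add: matrix_matrix_mult_def sum_block_2)

lemma block_mult_vec:
  "(block $ 1 *v y) $ i = (if \<kappa> i = 0 then 0 else y $ col_index (\<kappa> i - 1))"
  "(block $ 2 *v y) $ i = (if \<kappa> i = CARD('k) then 0 else - y $ col_index (\<kappa> i))"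
  by (simp_all add: matrix_vector_mult_def sum_block_1 sum_block_2)

lemma block_nondegenerate: "block \<in> nondegenerate_hypermatrices"
  unfolding nondegenerate_iff[OF card_eq]
proof (intro allI impI)
  fix x :: "complex^2" and y :: "complex^'k"
  assume x: "x \<noteq> 0" and "pencil block x *v y = 0"
  then have "(pencil block x *v y) $ i = 0" for i
    by simp
  then have eq: "x $ 1 * (if \<kappa> i = 0 then 0 else y $ col_index (\<kappa> i - 1))
      = x $ 2 * (if \<kappa> i = CARD('k) then 0 else y $ col_index (\<kappa> i))" for i
    by (simp add: pencil_mult_vec block_mult_vec eq_neg_iff_add_eq_0[symmetric] split: if_splits)
  have "n < CARD('k) \<Longrightarrow> y $ col_index n = 0" for n
  proof (cases "x $ 2 = 0")
    case True
    then have "x $ 1 \<noteq> 0" using x by (auto simp: vec_eq_iff forall_2)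
    moreover assume "n < CARD('k)"
    ultimately show ?thesis using True eq[of "row_index (Suc n)"] by simp
  next
    case False
    assume "n < CARD('k)"
    then show ?thesis
    proof (induction n)
      case 0
      then show ?case using eq[of "row_index 0"] False by simp
    next
      case (Suc n)
      then show ?case using eq[of "row_index (Suc n)"] False by simp
    qed
  qed
  then show "y = 0"
    using col_index_\<iota> \<iota>_less by (metis vec_eq_iff zero_index)
qed

text \<open>
  Comparing entries, \<open>C\<close> is a Toeplitz matrix whose first row vanishes to the right of the
  diagonal and whose last row vanishes to the left of it. So \<open>C\<close> is scalar, and \<open>D\<close> is a
  submatrix of it.
\<close>

lemma block_stabiliser:
  assumes "\<And>p. C ** block $ p = block $ p ** D"
  obtains c where "C = mat c" "D = mat c"
proof -
  define c where "c a b = C $ row_index a $ row_index b" for a b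
  define d where "d a b = D $ col_index a $ col_index b" for a b
  have c1: "c a (Suc b) = (if a = 0 then 0 else d (a - 1) b)" if "a \<le> CARD('k)" "b < CARD('k)" for a b
    using arg_cong[OF assms[of 1], of "\<lambda>A. A $ row_index a $ col_index b"] that
    by (simp add: mult_block_1 block_mult_1 c_def d_def)
  have c2: "c a b = (if a = CARD('k) then 0 else d a b)" if "a \<le> CARD('k)" "b < CARD('k)" for a b
    using arg_cong[OF assms[of 2], of "\<lambda>A. A $ row_index a $ col_index b"] that
    by (simp add: mult_block_2 block_mult_2 c_def d_def split: if_splits)
  have shift: "c (Suc a) (Suc b) = c a b" if "a < CARD('k)" "b < CARD('k)" for a b
    using c1[of "Suc a" b] c2[of a b] that by simp
  have upper: "c a b = 0" if "a < b" "b \<le> CARD('k)" for a b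
    using that
  proof (induction a arbitrary: b)
    case 0
    then show ?case using c1[of 0 "b - 1"] by simp
  next
    case (Suc a)
    then show ?case using shift[of a "b - 1"] by simp
  qed
  have lower: "c a b = 0" if "a \<le> CARD('k)" "b < a" for a b
    using that
  proof (induction "CARD('k) - a" arbitrary: a b)
    case 0
    then show ?case using c2[of a b] by simp
  next
    case (Suc n)
    then show ?case using shift[of a b] Suc.hyps(1)[of "Suc a" "Suc b"] by simp
  qed
  have diag: "c a a = c 0 0" if "a \<le> CARD('k)" for a
    using that by (induction a) (simp_all add: shift)
  have c: "c a b = (if a = b then c 0 0 else 0)" if "a \<le> CARD('k)" "b \<le> CARD('k)" for a b
    using upper[of a b] lower[of a b] diag[of a] that by (cases a b rule: linorder_cases) auto
  have "C $ i $ j = mat (c 0 0) $ i $ j" for i j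
    using c[of "\<kappa> i" "\<kappa> j"] row_index_\<kappa>[of i] row_index_\<kappa>[of j] by (auto simp: mat_def c_def)
  then have "C = mat (c 0 0)" by (simp add: vec_eq_iff)
  moreover have "D $ i $ j = mat (c 0 0) $ i $ j" for i j
    using c[of "\<iota> i" "\<iota> j"] c2[of "\<iota> i" "\<iota> j"] \<iota>_less[of i] \<iota>_less[of j]
      col_index_\<iota>[of i] col_index_\<iota>[of j]
    by (auto simp: mat_def d_def less_imp_le)
  then have "D = mat (c 0 0)" by (simp add: vec_eq_iff)
  ultimately show ?thesis using that by blast
qed

text \<open>
  With \<open>z\<^sub>i\<close> for the row of \<open>Z\<close> of number \<open>i\<close>, the conditions are
  \<open>z\<^sub>0 M\<^sub>1 = 0\<close>, \<open>z\<^sub>i\<^sub>+\<^sub>1 M\<^sub>1 = - z\<^sub>i M\<^sub>2\<close> and \<open>z\<^sub>k M\<^sub>2 = 0\<close>. They say that the polynomial vector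
  \<open>z\<^sub>0 + z\<^sub>1 t + \<dots> + z\<^sub>k t\<^sup>k\<close> is annihilated from the right by \<open>M\<^sub>1 + t M\<^sub>2\<close>.
\<close>

definition syzygy :: "complex^'k^'m^2 \<Rightarrow> complex^'m^'m \<Rightarrow> bool" where
  "syzygy M Z \<longleftrightarrow>
     (\<forall>i. (Z ** M $ 1) $ i = (if \<kappa> i = 0 then 0 else - (Z ** M $ 2) $ row_index (\<kappa> i - 1))) \<and>
     (Z ** M $ 2) $ row_index CARD('k) = 0"

text \<open>
  The \<open>(k + 1)\<^sup>2\<close> entries of \<open>Z\<close> satisfy \<open>(k + 2) k\<close> linear equations, one fewer. The extra
  index \<open>None\<close> stands for the condition on the last row.
\<close>

lemma exists_syzygy:
  fixes M :: "complex^'k^'m^2"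
  obtains Z where "Z \<noteq> 0" "syzygy M Z"
proof -
  define f :: "complex^'m^'m \<Rightarrow> complex^'k^('m option)" where
    "f Z = (\<chi> r. case r of Some i \<Rightarrow> (Z ** M $ 1) $ i + (if \<kappa> i = 0 then 0 else (Z ** M $ 2) $ row_index (\<kappa> i - 1))
       | None \<Rightarrow> (Z ** M $ 2) $ row_index CARD('k))" for Z
  have "linear f"
    by (rule linearI)
      (auto simp: f_def vec_eq_iff matrix_matrix_mult_def sum.distrib[symmetric] algebra_simps
        scaleR_sum_right split: option.split)
  moreover have "DIM(complex^'k^('m option)) < DIM(complex^'m^'m)"
    by (simp add: card_eq)
  ultimately obtain Z where Z: "Z \<noteq> 0" "f Z = 0"
    using linear_to_smaller_dim_not_injective by blast
  have "syzygy M Z"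
    unfolding syzygy_def
  proof (intro conjI allI)
    show "(Z ** M $ 1) $ i = (if \<kappa> i = 0 then 0 else - (Z ** M $ 2) $ row_index (\<kappa> i - 1))" for i
      using arg_cong[OF Z(2), of "\<lambda>v. v $ Some i"] by (auto simp: f_def eq_neg_iff_add_eq_0)
    show "(Z ** M $ 2) $ row_index CARD('k) = 0"
      using arg_cong[OF Z(2), of "\<lambda>v. v $ None"] by (simp add: f_def)
  qed
  with Z(1) that show ?thesis by blast
qed

lemma syzygy_mult_vec:
  assumes "syzygy M Z"
  shows "(Z *v (M $ 1 *v y)) $ i = (if \<kappa> i = 0 then 0 else - (Z *v (M $ 2 *v y)) $ row_index (\<kappa> i - 1))"
    and "(Z *v (M $ 2 *v y)) $ row_index CARD('k) = 0"
proof -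
  have "(Z *v (M $ p *v y)) $ i = (\<Sum>j\<in>UNIV. (Z ** M $ p) $ i $ j * y $ j)" for p i
    by (simp only: matrix_vector_mul_assoc) (simp add: matrix_vector_mult_def)
  then show "(Z *v (M $ 1 *v y)) $ i = (if \<kappa> i = 0 then 0 else - (Z *v (M $ 2 *v y)) $ row_index (\<kappa> i - 1))"
    and "(Z *v (M $ 2 *v y)) $ row_index CARD('k) = 0"
    using assms by (simp_all add: syzygy_def sum_negf)
qed

lemma syzygy_kernels:
  assumes "syzygy M Z"
  shows "Z *v (M $ 1 *v y) = 0 \<longleftrightarrow> Z *v (M $ 2 *v y) = 0"
proof
  assume 0: "Z *v (M $ 1 *v y) = 0"
  show "Z *v (M $ 2 *v y) = 0"
    unfolding vec_eq_iff
  proof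
    fix i
    show "(Z *v (M $ 2 *v y)) $ i = 0 $ i"
    proof (cases "\<kappa> i = CARD('k)")
      case True
      then show ?thesis using syzygy_mult_vec(2)[OF assms, of y] row_index_\<kappa>[of i] by simp
    next
      case False
      then have "Suc (\<kappa> i) \<le> CARD('k)" using \<kappa>_less by (simp add: Suc_le_eq)
      then show ?thesis using syzygy_mult_vec(1)[OF assms, of y "row_index (Suc (\<kappa> i))"] 0 by simp
    qed
  qed
next
  assume "Z *v (M $ 2 *v y) = 0"
  then show "Z *v (M $ 1 *v y) = 0"
    using syzygy_mult_vec(1)[OF assms, of y] by (simp add: vec_eq_iff)
qed

text \<open>
  Suppose that \<open>Z\<close> has a kernel \<open>Y \<noteq> 0\<close>, and let \<open>X\<close> be the preimage of \<open>Y\<close> under \<open>M\<^sub>1\<close>, which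
  is also the preimage under \<open>M\<^sub>2\<close>. If \<open>Y\<close> is contained in the image of \<open>M\<^sub>1\<close>, then
  \<open>M\<^sub>1\<inverse> M\<^sub>2\<close> is an endomorphism of \<open>X \<noteq> 0\<close>, and an eigenvector of it is a kernel vector of
  some \<open>M\<^sub>2 - c M\<^sub>1\<close>, against nondegeneracy. Otherwise \<open>Y\<close> contains a complement of the image of
  the injective matrix \<open>M\<^sub>1\<close>. Then every row \<open>z\<^sub>i\<close> is determined by its values on this image:
  \<open>z\<^sub>0 M\<^sub>1 = 0\<close> forces \<open>z\<^sub>0 = 0\<close>, then \<open>z\<^sub>1 M\<^sub>1 = - z\<^sub>0 M\<^sub>2 = 0\<close> forces \<open>z\<^sub>1 = 0\<close>, and so on, whence
  \<open>Z = 0\<close>.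
\<close>

lemma syzygy_invertible:
  fixes M :: "complex^'k^'m^2"
  assumes M: "M \<in> nondegenerate_hypermatrices" and Z: "syzygy M Z" "Z \<noteq> 0"
  shows "invertible Z"
proof (rule ccontr)
  have nd: "y = 0" if "a \<noteq> 0 \<or> b \<noteq> 0" "a *s (M $ 1 *v y) + b *s (M $ 2 *v y) = 0" for a b y
  proof -
    have "pencil M (vector [a, b]) *v y = 0" "(vector [a, b] :: complex^2) \<noteq> 0"
      using that by (auto simp: pencil_mult_vec vec_eq_iff forall_2)
    with M show ?thesis by (simp add: nondegenerate_iff[OF card_eq])
  qed
  obtain G where G: "G ** M $ 1 = mat 1"
    using matrix_left_invertible_ker[of "M $ 1"] nd[of 1 0] by auto
  have inj: "inj ((*v) (M $ 1))"
    using G by (metis matrix_left_invertible_injective)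
  assume "\<not> invertible Z"
  then obtain w where w: "w \<noteq> 0" "Z *v w = 0"
    using invertible_left_inverse[of Z] matrix_left_invertible_ker[of Z] by auto
  show False
  proof (cases "\<forall>w. Z *v w = 0 \<longrightarrow> w \<in> range ((*v) (M $ 1))")
    case True
    define X where "X = {y. Z *v (M $ 1 *v y) = 0}"
    have X: "vec.subspace X"
      by (auto simp: X_def vec.subspace_def vec.add vec.scale)
    have solve: "M $ 2 *v y = M $ 1 *v ((G ** M $ 2) *v y)" if "y \<in> X" for y
    proof -
      have "Z *v (M $ 2 *v y) = 0"
        using that syzygy_kernels[OF Z(1)] by (simp add: X_def)
      then obtain y' where y': "M $ 2 *v y = M $ 1 *v y'"
        using True by (auto simp: image_iff)
      then have "(G ** M $ 2) *v y = y'"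
        by (simp add: matrix_vector_mul_assoc[symmetric]) (simp add: matrix_vector_mul_assoc G)
      with y' show ?thesis by simp
    qed
    obtain y where y: "w = M $ 1 *v y"
      using True w by auto
    then have "y \<in> X" "y \<noteq> 0"
      using w by (auto simp: X_def)
    moreover have "(G ** M $ 2) *v v \<in> X" if "v \<in> X" for v
      using solve[OF that] that syzygy_kernels[OF Z(1)] by (simp add: X_def)
    ultimately obtain v c where v: "v \<in> X" "v \<noteq> 0" "(G ** M $ 2) *v v = c *s v"
      using eigenvector_in_invariant_subspace[OF matrix_vector_mul_linear_gen X, of "G ** M $ 2" y] by blast
    then have "M $ 2 *v v = c *s (M $ 1 *v v)"
      using solve by (simp add: vec.scale)
    then have "(-c) *s (M $ 1 *v v) + 1 *s (M $ 2 *v v) = 0"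
      by (simp add: vec_eq_iff)
    then have "v = 0"
      using nd[of "-c" 1 v] by simp
    with v show False by simp
  next
    case False
    then obtain w where w: "Z *v w = 0" "w \<notin> range ((*v) (M $ 1))" by blast
    have sub: "vec.subspace (range ((*v) (M $ 1)))"
      using vec.subspace_image[OF vec.subspace_UNIV] by blast
    then have span_range: "vec.span (range ((*v) (M $ 1))) = range ((*v) (M $ 1))"
      by (simp add: vec.span_eq_iff)
    have "vec.dim (range ((*v) (M $ 1))) = CARD('k)"
      using vec.dim_image_eq[OF matrix_vector_mul_linear_gen, of "M $ 1" UNIV] inj
      by (simp add: card_cart_basis)
    then have "vec.dim (insert w (range ((*v) (M $ 1)))) = CARD('m)"
      using w(2) by (simp add: vec.dim_insert span_range card_eq)
    then have full: "vec.span (insert w (range ((*v) (M $ 1)))) = UNIV"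
      using vec.dim_eq_span[of "insert w (range ((*v) (M $ 1)))" UNIV] by (simp add: card_cart_basis)
    have decomp: "\<exists>y t. v = M $ 1 *v y + t *s w" for v
    proof -
      have "v \<in> vec.span (insert w (range ((*v) (M $ 1))))" by (simp add: full)
      then obtain t where "v - t *s w \<in> range ((*v) (M $ 1))"
        unfolding vec.span_breakdown_eq span_range by blast
      then obtain y where "v - t *s w = M $ 1 *v y" by blast
      then have "v = M $ 1 *v y + t *s w" by (simp add: diff_eq_eq)
      then show ?thesis by blast
    qed
    have Zv: "n \<le> CARD('k) \<Longrightarrow> (Z *v v) $ row_index n = 0" for n v
    proof (induction n arbitrary: v)
      case 0
      obtain y t where "v = M $ 1 *v y + t *s w" using decomp by blast
      then show ?case
        using syzygy_mult_vec(1)[OF Z(1), of y "row_index 0"] by (simp add: vec.add vec.scale w)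
    next
      case (Suc n)
      obtain y t where "v = M $ 1 *v y + t *s w" using decomp by blast
      then show ?case
        using syzygy_mult_vec(1)[OF Z(1), of y "row_index (Suc n)"] Suc by (simp add: vec.add vec.scale w)
    qed
    have "Z *v v = 0" for v
      using Zv[OF \<kappa>_le] by (simp add: vec_eq_iff)
    then have "Z = 0"
      using matrix_eq[of Z 0] by simp
    with Z show False by simp
  qed
qed

text \<open>
  In terms of the rows of \<open>Z M\<^sub>1\<close> and \<open>Z M\<^sub>2\<close>, a syzygy states exactly that the two matrices
  consist of the same \<open>k\<close> rows, up to sign, preceded by a zero row in the first and
  followed by one in the second.
\<close>

lemma syzygy_normal_form:
  fixes M :: "complex^'k^'m^2"
  assumes "syzygy M Z"
  obtains P where "\<And>p. Z ** M $ p = block $ p ** P"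
proof -
  define P :: "complex^'k^'k" where "P = (\<chi> j. (Z ** M $ 1) $ row_index (Suc (\<iota> j)))"
  have "Z ** M $ 1 = block $ 1 ** P"
  proof -
    have "(Z ** M $ 1) $ i $ l = (block $ 1 ** P) $ i $ l" for i l
      using assms \<kappa>_le[of i] by (cases "\<kappa> i") (auto simp: syzygy_def block_mult_1 P_def Suc_le_eq)
    then show ?thesis by (simp add: vec_eq_iff)
  qed
  moreover have "Z ** M $ 2 = block $ 2 ** P"
  proof -
    have "(Z ** M $ 2) $ i $ l = (block $ 2 ** P) $ i $ l" for i l
    proof (cases "\<kappa> i = CARD('k)")
      case True
      then have "i = row_index CARD('k)" by (metis row_index_\<kappa>)
      then show ?thesis using assms by (simp add: syzygy_def block_mult_2)
    next
      case False
      then have *: "\<kappa> i < CARD('k)" by (rule \<kappa>_less)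
      then have "(Z ** M $ 1) $ row_index (Suc (\<kappa> i)) = - (Z ** M $ 2) $ i"
        using assms by (simp add: syzygy_def)
      then show ?thesis using * by (simp add: block_mult_2 P_def)
    qed
    then show ?thesis by (simp add: vec_eq_iff)
  qed
  ultimately have "Z ** M $ p = block $ p ** P" for p
    using exhaust_2[of p] by auto
  then show ?thesis using that by blast
qed

theorem nondegenerate_equiv_block:
  fixes M :: "complex^'k^'m^2"
  assumes M: "M \<in> nondegenerate_hypermatrices"
  obtains B A where "invertible B" "invertible A" "M = act B block A"
proof -
  obtain Z where Z: "Z \<noteq> 0" "syzygy M Z" by (rule exists_syzygy)
  then have "invertible Z" using syzygy_invertible[OF M] by blast
  then obtain B where B: "B ** Z = mat 1" "Z ** B = mat 1"
    by (auto simp: invertible_def)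
  obtain P where P: "\<And>p. Z ** M $ p = block $ p ** P"
    using syzygy_normal_form[OF Z(2)] by metis
  have MP: "M $ p = B ** block $ p ** P" for p
    using arg_cong[OF P[of p], of "(**) B"] by (simp add: matrix_mul_assoc B)
  have "invertible P"
  proof -
    have "y = 0" if "P *v y = 0" for y
    proof -
      have "M $ p *v y = 0" for p
        using that by (simp add: MP matrix_vector_mul_assoc[symmetric])
      then have "pencil M (axis 1 1) *v y = 0"
        by (simp add: pencil_mult_vec)
      moreover have "axis 1 1 \<noteq> (0 :: complex^2)"
        by (simp add: axis_eq_0_iff)
      ultimately show ?thesis
        using M nondegenerate_iff[OF card_eq] by blast
    qed
    then show ?thesis
      using invertible_left_inverse[of P] matrix_left_invertible_ker[of P] by auto
  qed
  moreover have "invertible B" using B by (auto simp: invertible_def)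
  moreover have "M = act B block P" using MP by (simp add: act_def vec_eq_iff)
  ultimately show ?thesis using that by blast
qed

end

section \<open>The orbit map of the general linear groups\<close>

lemma continuous_on_matrix_mult [continuous_intros]:
  fixes f :: "'a::topological_space \<Rightarrow> complex^'n^'m" and g :: "'a \<Rightarrow> complex^'k^'n"
  assumes "continuous_on S f" "continuous_on S g"
  shows "continuous_on S (\<lambda>x. f x ** g x)"
  unfolding matrix_matrix_mult_def by (intro continuous_intros assms)

lemma continuous_on_det [continuous_intros]:
  fixes f :: "'a::topological_space \<Rightarrow> complex^'n^'n"
  assumes "continuous_on S f"
  shows "continuous_on S (\<lambda>x. det (f x))"
  unfolding det_def by (intro continuous_intros assms)

lemma general_linear_eq: "general_linear = {A :: complex^'n^'n. det A \<noteq> 0}"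
  by (auto simp: general_linear_def invertible_det_nz)

lemma open_general_linear: "open (general_linear :: (complex^'n^'n) set)"
proof -
  have "general_linear = (det :: complex^'n^'n \<Rightarrow> complex) -` (- {0})"
    by (auto simp: general_linear_eq)
  moreover have "open ((det :: complex^'n^'n \<Rightarrow> complex) -` (- {0}))"
    by (intro open_vimage continuous_intros)
  ultimately show ?thesis by simp
qed

lemma continuous_on_act [continuous_intros]:
  assumes "continuous_on S f" "continuous_on S g" "continuous_on S h"
  shows "continuous_on S (\<lambda>x. act (f x) (g x) (h x))"
  unfolding act_def by (intro continuous_intros assms)

lemma det_mat: "det (mat c :: complex^'n^'n) = c ^ CARD('n)"
proof -
  have "det (mat c :: complex^'n^'n) = (\<Prod>i\<in>UNIV. (mat c :: complex^'n^'n) $ i $ i)"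
    by (rule det_diagonal) (simp add: mat_def)
  then show ?thesis by (simp add: mat_def)
qed

lemma mat_mult_left: "(mat c ** A) $ i $ j = c * (A :: complex^'n^'m) $ i $ j"
  by (simp add: matrix_matrix_mult_def mat_def if_distrib[of "\<lambda>u. u * _"] cong: if_cong)

lemma mat_mult_right: "(A ** mat c) $ i $ j = c * (A :: complex^'n^'m) $ i $ j"
  by (simp add: matrix_matrix_mult_def mat_def if_distrib[of "\<lambda>u. _ * u"] mult.commute cong: if_cong)

lemma mat_commute: "mat c ** A = (A :: complex^'n^'m) ** mat c"
  by (simp add: vec_eq_iff mat_mult_left mat_mult_right)

lemma exists_kronecker_indexing:
  assumes "CARD('m::finite) = CARD('k::finite) + 1"
  obtains \<iota> :: "'k::finite \<Rightarrow> nat" and \<kappa> :: "'m::finite \<Rightarrow> nat" where "kronecker_indexing \<iota> \<kappa>"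
proof -
  obtain \<iota> :: "'k \<Rightarrow> nat" where "bij_betw \<iota> UNIV {0..<CARD('k)}"
    using ex_bij_betw_finite_nat[OF finite] by blast
  moreover obtain \<kappa> :: "'m \<Rightarrow> nat" where "bij_betw \<kappa> UNIV {0..<CARD('m)}"
    using ex_bij_betw_finite_nat[OF finite] by blast
  moreover have "{0..<CARD('k)} = {..<CARD('k)}" "{0..<CARD('m)} = {..CARD('k)}"
    using assms by auto
  ultimately have "kronecker_indexing \<iota> \<kappa>"
    unfolding kronecker_indexing_def by metis
  then show ?thesis by (rule that)
qed

lemma nondegenerate_nonempty:
  assumes "CARD('m::finite) = CARD('k::finite) + 1"
  shows "(nondegenerate_hypermatrices :: (complex^'k::finite^'m::finite^2) set) \<noteq> {}"
proof -
  obtain \<iota> :: "'k \<Rightarrow> nat" and \<kappa> :: "'m \<Rightarrow> nat" where "kronecker_indexing \<iota> \<kappa>"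
    using exists_kronecker_indexing[OF assms] .
  then show ?thesis using kronecker_indexing.block_nondegenerate by blast
qed

text \<open>
  Both hypermatrices are equivalent to the same block. The determinants can be adjusted without
  moving the hypermatrix, as \<open>(s\<inverse> I, s I)\<close> acts trivially and multiplies
  \<open>det A det B\<close> by \<open>s\<close>.
\<close>

lemma act_transitive:
  fixes a a' :: "complex^'k^'m^2"
  assumes card: "CARD('m) = CARD('k) + 1"
    and "a \<in> nondegenerate_hypermatrices" "a' \<in> nondegenerate_hypermatrices" and d: "d \<noteq> 0"
  obtains B A where "invertible B" "invertible A" "act B a A = a'" "det A * det B = d"
proof -
  obtain \<iota> :: "'k \<Rightarrow> nat" and \<kappa> :: "'m \<Rightarrow> nat" where "kronecker_indexing \<iota> \<kappa>"
    using exists_kronecker_indexing[OF card] .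
  then interpret kronecker_indexing \<iota> \<kappa> .
  obtain B A where a: "invertible B" "invertible A" "a = act B block A"
    using nondegenerate_equiv_block[OF assms(2)] .
  obtain B' A' where a': "invertible B'" "invertible A'" "a' = act B' block A'"
    using nondegenerate_equiv_block[OF assms(3)] .
  obtain BI where BI: "B ** BI = mat 1" "BI ** B = mat 1"
    using a(1) by (auto simp: invertible_def)
  obtain AI where AI: "A ** AI = mat 1" "AI ** A = mat 1"
    using a(2) by (auto simp: invertible_def)
  have inv: "invertible BI" "invertible AI"
    using BI AI by (auto simp: invertible_def)
  define s where "s = d / (det (AI ** A') * det (B' ** BI))"
  have dets: "det (AI ** A') \<noteq> 0" "det (B' ** BI) \<noteq> 0"
    using inv a' invertible_mult invertible_det_nz by blast+
  then have s: "s \<noteq> 0" using d by (simp add: s_def)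
  let ?B = "mat s ** (B' ** BI)" and ?A = "mat (inverse s) ** (AI ** A')"
  have "det ?A * det ?B = inverse s ^ CARD('k) * s ^ CARD('m) * (det (AI ** A') * det (B' ** BI))"
    by (simp add: det_mul[of "mat _"] det_mat)
  also have "inverse s ^ CARD('k) * s ^ CARD('m) = s"
    using s by (simp add: card field_simps)
  finally have det: "det ?A * det ?B = d"
    using dets by (simp add: s_def)
  moreover from this d have "invertible ?A" "invertible ?B"
    by (auto simp: invertible_det_nz)
  moreover have "act ?B a ?A = a'"
  proof -
    have "act ?B a ?A = act (mat s) (act (B' ** BI) a (AI ** A')) (mat (inverse s))"
      by (simp add: act_act mat_commute[of _ "AI ** A'"])
    also have "act (B' ** BI) a (AI ** A') = a'"
    proof -
      have "act (B' ** BI) a (AI ** A') = act (B' ** (BI ** B)) block ((A ** AI) ** A')"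
        unfolding a(3) act_act by (simp add: matrix_mul_assoc)
      then show ?thesis by (simp add: BI AI a')
    qed
    also have "act (mat s) a' (mat (inverse s)) = a'"
      using s by (simp add: act_def vec_eq_iff mat_mult_left mat_mult_right)
    finally show ?thesis .
  qed
  ultimately show ?thesis using that by blast
qed

text \<open>
  Two pairs with the same action differ by a stabiliser element \<open>(c\<inverse> I, c I)\<close>, and equality
  of \<open>det A det B\<close> yields \<open>c\<^sup>k\<^sup>+\<^sup>1 = c\<^sup>k\<close>.
\<close>

lemma act_free:
  fixes a :: "complex^'k^'m^2"
  assumes card: "CARD('m) = CARD('k) + 1" and "a \<in> nondegenerate_hypermatrices"
    and inv: "invertible A" "invertible B" "invertible A'" "invertible B'"
    and eq: "act B a A = act B' a A'" and det: "det A * det B = det A' * det B'"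
  shows "A = A' \<and> B = B'"
proof -
  obtain \<iota> :: "'k \<Rightarrow> nat" and \<kappa> :: "'m \<Rightarrow> nat" where "kronecker_indexing \<iota> \<kappa>"
    using exists_kronecker_indexing[OF card] .
  then interpret kronecker_indexing \<iota> \<kappa> .
  obtain B0 A0 where a: "invertible B0" "invertible A0" "a = act B0 block A0"
    using nondegenerate_equiv_block[OF assms(2)] .
  have "invertible (B' ** B0)" "invertible (A0 ** A)"
    using a inv invertible_mult by blast+
  then obtain BI AI where BI: "(B' ** B0) ** BI = mat 1" "BI ** (B' ** B0) = mat 1"
    and AI: "(A0 ** A) ** AI = mat 1" "AI ** (A0 ** A) = mat 1"
    by (auto simp: invertible_def)
  define C D where "C = BI ** (B ** B0)" and "D = (A0 ** A') ** AI"
  have "C ** block $ p = block $ p ** D" for p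
  proof -
    have "(B ** B0) ** block $ p ** (A0 ** A) = (B' ** B0) ** block $ p ** (A0 ** A')"
      using arg_cong[OF eq, of "\<lambda>v. v $ p"] unfolding a(3) act_act by (simp add: act_def)
    then have "BI ** ((B ** B0) ** block $ p ** (A0 ** A)) ** AI
        = BI ** ((B' ** B0) ** block $ p ** (A0 ** A')) ** AI"
      by simp
    then have "C ** block $ p ** ((A0 ** A) ** AI) = (BI ** (B' ** B0)) ** block $ p ** D"
      by (simp add: C_def D_def matrix_mul_assoc)
    then show ?thesis by (simp add: BI AI)
  qed
  then obtain c where c: "C = mat c" "D = mat c"
    using block_stabiliser by blast
  have "(B' ** B0) ** C = (B' ** B0 ** BI) ** (B ** B0)"
    by (simp add: C_def matrix_mul_assoc)
  then have "(B' ** mat c) ** B0 = B ** B0"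
    by (simp add: BI c mat_commute[symmetric] matrix_mul_assoc)
  then have B: "B = B' ** mat c"
    using a(1) by (metis invertible_def matrix_mul_assoc matrix_mul_rid)
  have "D ** (A0 ** A) = (A0 ** A') ** (AI ** (A0 ** A))"
    by (simp add: D_def matrix_mul_assoc)
  then have "D ** (A0 ** A) = A0 ** A'"
    by (simp only: AI matrix_mul_rid)
  then have "A0 ** (A ** mat c) = A0 ** A'"
    unfolding c mat_commute[of _ "A0 ** A"] by (simp only: matrix_mul_assoc)
  then have A: "A' = A ** mat c"
    using a(2) by (metis invertible_def matrix_mul_assoc matrix_mul_lid)
  have nz: "det A \<noteq> 0" "det B' \<noteq> 0" "det A' \<noteq> 0"
    using inv by (auto simp: invertible_det_nz)
  have "c \<noteq> 0" using nz(3) unfolding A by (auto simp: det_mul det_mat)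
  moreover have "c ^ CARD('m) = c ^ CARD('k)"
    using det nz unfolding A B by (simp add: det_mul det_mat)
  ultimately have "c = 1" by (simp add: card)
  then show ?thesis using A B by simp
qed

definition orbit_map ::
    "complex^'k^'m^2 \<Rightarrow> (complex^'k^'k) \<times> (complex^'m^'m) \<Rightarrow> (complex^'k^'m^2) \<times> complex" where
  "orbit_map a = (\<lambda>(A, B). (act B a A, det A * det B))"

text \<open>
  Freeness and transitivity make the map bijective. Invariance of domain applies because
  the ambient spaces of domain and target have the same dimension, and it provides the
  continuity of the inverse without a formula for it.
\<close>

lemma orbit_map_homeomorphism:
  fixes a :: "complex^'k^'m^2"
  assumes card: "CARD('m) = CARD('k) + 1" and a: "a \<in> nondegenerate_hypermatrices"
  obtains g where
    "homeomorphism (general_linear \<times> general_linear) (nondegenerate_hypermatrices \<times> - {0}) (orbit_map a) g"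
proof -
  let ?G = "general_linear \<times> general_linear :: ((complex^'k^'k) \<times> (complex^'m^'m)) set"
  have "open ?G"
    by (intro open_Times open_general_linear)
  moreover have "continuous_on ?G (orbit_map a)"
    unfolding orbit_map_def case_prod_beta by (intro continuous_intros)
  moreover have "DIM((complex^'k^'m^2) \<times> complex) \<le> DIM((complex^'k^'k) \<times> (complex^'m^'m))"
    by (simp add: card)
  moreover have "inj_on (orbit_map a) ?G"
    using act_free[OF card a] by (auto simp: inj_on_def orbit_map_def general_linear_def)
  ultimately obtain g where "homeomorphism ?G (orbit_map a ` ?G) (orbit_map a) g"
    by (rule invariance_of_domain_homeomorphism)
  moreover have "orbit_map a ` ?G = nondegenerate_hypermatrices \<times> - {0}"
  proof
    show "orbit_map a ` ?G \<subseteq> nondegenerate_hypermatrices \<times> - {0}"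
      using act_nondegenerate[OF card] a
      by (auto simp: orbit_map_def general_linear_def invertible_det_nz)
    show "nondegenerate_hypermatrices \<times> - {0} \<subseteq> orbit_map a ` ?G"
    proof
      fix x :: "(complex^'k^'m^2) \<times> complex"
      assume "x \<in> nondegenerate_hypermatrices \<times> - {0}"
      then obtain a' d where x: "x = (a', d)" and "a' \<in> nondegenerate_hypermatrices" "d \<noteq> 0"
        by auto
      then obtain B A where "invertible B" "invertible A" "act B a A = a'" "det A * det B = d"
        using act_transitive[OF card a] by blast
      then have "(A, B) \<in> ?G" "orbit_map a (A, B) = (a', d)"
        by (auto simp: orbit_map_def general_linear_def)
      then show "x \<in> orbit_map a ` ?G" unfolding x by (metis imageI)
    qed
  qed
  ultimately show ?thesis using that by simp
qed

section \<open>The special linear group is simply connected\<close>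

definition special_linear :: "(complex^'n^'n) set" where
  "special_linear = {A. det A = 1}"

definition row_transvection :: "'n \<Rightarrow> ('n \<Rightarrow> complex) \<Rightarrow> complex^'n^'n" where
  "row_transvection j w = (\<chi> i l. if i = l then 1 else if i = j then w l else 0)"

definition column_transvection :: "'n \<Rightarrow> ('n \<Rightarrow> complex) \<Rightarrow> complex^'n^'n" where
  "column_transvection j v = (\<chi> i l. if i = l then 1 else if l = j then v i else 0)"

lemma row_transvection_mult:
  "(row_transvection j w ** A) $ i $ l =
     (if i = j then A $ j $ l + (\<Sum>m\<in>-{j}. w m * A $ m $ l) else A $ i $ l)"
proof (cases "i = j")
  case True
  have "(\<Sum>m\<in>UNIV. row_transvection j w $ j $ m * A $ m $ l)
      = A $ j $ l + (\<Sum>m\<in>UNIV - {j}. row_transvection j w $ j $ m * A $ m $ l)"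
    by (subst sum.remove[of _ j]) (auto simp: row_transvection_def)
  also have "(\<Sum>m\<in>UNIV - {j}. row_transvection j w $ j $ m * A $ m $ l) = (\<Sum>m\<in>-{j}. w m * A $ m $ l)"
    by (rule sum.cong) (auto simp: row_transvection_def)
  finally show ?thesis using True by (simp add: matrix_matrix_mult_def)
next
  case False
  then show ?thesis
    by (simp add: matrix_matrix_mult_def row_transvection_def if_distrib[of "\<lambda>u. u * _"] cong: if_cong)
qed

lemma column_transvection_mult:
  "(column_transvection j v ** A) $ i $ l = (if i = j then A $ j $ l else A $ i $ l + v i * A $ j $ l)"
proof -
  have "(column_transvection j v ** A) $ i $ l
      = (\<Sum>m\<in>UNIV. (if m = i then A $ i $ l else 0) + (if m = j then (if i = j then 0 else v i * A $ j $ l) else 0))"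
    unfolding matrix_matrix_mult_def vec_lambda_beta
    by (intro sum.cong) (auto simp: column_transvection_def)
  then show ?thesis by (simp add: sum.distrib)
qed

lemma mult_row_transvection:
  "(A ** row_transvection j w) $ i $ l = (if l = j then A $ i $ j else A $ i $ l + A $ i $ j * w l)"
proof -
  have "(A ** row_transvection j w) $ i $ l
      = (\<Sum>m\<in>UNIV. (if m = l then A $ i $ l else 0) + (if m = j then (if l = j then 0 else A $ i $ j * w l) else 0))"
    unfolding matrix_matrix_mult_def vec_lambda_beta
    by (intro sum.cong) (auto simp: row_transvection_def)
  then show ?thesis by (simp add: sum.distrib)
qed

lemma row_transvection_inverse: "row_transvection j (\<lambda>l. - w l) ** row_transvection j w = mat 1"
  by (auto simp: vec_eq_iff mult_row_transvection) (auto simp: row_transvection_def mat_def)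

lemma column_transvection_inverse: "column_transvection j (\<lambda>l. - w l) ** column_transvection j w = mat 1"
  by (auto simp: vec_eq_iff column_transvection_mult) (auto simp: column_transvection_def mat_def)

lemma det_row_transvection:
  fixes w :: "'n::finite \<Rightarrow> complex"
  shows "det (row_transvection j w) = 1"
proof -
  define x where "x = (\<Sum>l\<in>-{j}. w l *s row l (mat 1 :: complex^'n^'n))"
  have x: "x $ l = (if l = j then 0 else w l)" for l
    by (auto simp: x_def row_def mat_def sum.delta if_distrib[of "\<lambda>u. _ * u"] cong: if_cong)
  have "x \<in> vec.span {row l (mat 1 :: complex^'n^'n) |l. l \<noteq> j}"
    unfolding x_def by (intro vec.span_sum vec.span_scale vec.span_base) auto
  then have "det (\<chi> k. if k = j then row j (mat 1) + x else row k (mat 1)) = det (mat 1 :: complex^'n^'n)"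
    by (rule det_row_span)
  also have "(\<chi> k. if k = j then row j (mat 1) + x else row k (mat 1)) = row_transvection j w"
    by (auto simp: vec_eq_iff row_transvection_def x row_def mat_def)
  finally show ?thesis by simp
qed

lemma det_column_transvection: "det (column_transvection j w) = 1"
proof -
  have "column_transvection j w = transpose (row_transvection j w)"
    by (auto simp: vec_eq_iff row_transvection_def column_transvection_def transpose_def)
  then show ?thesis by (simp add: det_row_transvection)
qed

definition nullhomotopic_loop :: "(real \<Rightarrow> complex^'n^'n) \<Rightarrow> bool" where
  "nullhomotopic_loop A \<longleftrightarrow> homotopic_loops special_linear A (\<lambda>_. mat 1)"

lemma nullhomotopic_loop_iff:
  "nullhomotopic_loop A \<longleftrightarrow>
    (\<exists>h :: real \<times> real \<Rightarrow> _. continuous_on ({0..1} \<times> {0..1}) h \<and>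
      (\<forall>s\<in>{0..1}. \<forall>t\<in>{0..1}. det (h (s, t)) = 1) \<and>
      (\<forall>t\<in>{0..1}. h (0, t) = A t \<and> h (1, t) = mat 1) \<and>
      (\<forall>s\<in>{0..1}. h (s, 1) = h (s, 0)))"
  unfolding nullhomotopic_loop_def homotopic_loops special_linear_def pathfinish_def pathstart_def o_def
  by (rule iff_exI) auto

lemma nullhomotopic_loop_mult:
  fixes A B :: "real \<Rightarrow> complex^'n^'n"
  assumes "nullhomotopic_loop A" "nullhomotopic_loop B"
  shows "nullhomotopic_loop (\<lambda>t. A t ** B t)"
proof -
  obtain h k :: "real \<times> real \<Rightarrow> complex^'n^'n" where "continuous_on ({0..1} \<times> {0..1}) h" "continuous_on ({0..1} \<times> {0..1}) k"
    "\<forall>s\<in>{0..1}. \<forall>t\<in>{0..1}. det (h (s, t)) = 1"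
    "\<forall>s\<in>{0..1}. \<forall>t\<in>{0..1}. det (k (s, t)) = 1"
    "\<forall>t\<in>{0..1}. h (0, t) = A t \<and> h (1, t) = mat 1"
    "\<forall>t\<in>{0..1}. k (0, t) = B t \<and> k (1, t) = mat 1"
    "\<forall>s\<in>{0..1}. h (s, 1) = h (s, 0)" "\<forall>s\<in>{0..1}. k (s, 1) = k (s, 0)"
    using assms unfolding nullhomotopic_loop_iff by blast
  moreover from this(1,2) have "continuous_on ({0..1} \<times> {0..1}) (\<lambda>x. h x ** k x)"
    by (rule continuous_on_matrix_mult)
  ultimately show ?thesis
    unfolding nullhomotopic_loop_iff
    by (intro exI[of _ "\<lambda>x. h x ** k x"]) (simp add: det_mul)
qed

lemma nullhomotopic_row_transvection:
  assumes "\<And>l. continuous_on {0..1} (\<lambda>t. w t l)" "w 0 = w 1"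
  shows "nullhomotopic_loop (\<lambda>t. row_transvection j (w t))"
  unfolding nullhomotopic_loop_iff
proof (intro exI[of _ "\<lambda>x. row_transvection j (\<lambda>l. of_real (1 - fst x) * w (snd x) l)"] conjI ballI)
  have *: "continuous_on ({0..1::real} \<times> {0..1}) (\<lambda>x. w (snd x) l)" for l
    by (rule continuous_on_compose2[OF assms(1)]) (auto intro!: continuous_intros)
  have "continuous_on ({0..1} \<times> {0..1})
       (\<lambda>x. if i = l then 1 else if i = j then of_real (1 - fst x) * w (snd x) l else 0)" for i l
    by (cases "i = l"; cases "i = j") (auto intro!: continuous_intros *)
  then show "continuous_on ({0..1} \<times> {0..1})
       (\<lambda>x. row_transvection j (\<lambda>l. complex_of_real (1 - fst x) * w (snd x) l))"
    unfolding row_transvection_def by (intro continuous_on_vec_lambda)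
qed (simp_all add: det_row_transvection assms(2), simp_all add: row_transvection_def mat_def vec_eq_iff)

lemma nullhomotopic_column_transvection:
  assumes "\<And>l. continuous_on {0..1} (\<lambda>t. w t l)" "w 0 = w 1"
  shows "nullhomotopic_loop (\<lambda>t. column_transvection j (w t))"
  unfolding nullhomotopic_loop_iff
proof (intro exI[of _ "\<lambda>x. column_transvection j (\<lambda>l. of_real (1 - fst x) * w (snd x) l)"] conjI ballI)
  have *: "continuous_on ({0..1::real} \<times> {0..1}) (\<lambda>x. w (snd x) l)" for l
    by (rule continuous_on_compose2[OF assms(1)]) (auto intro!: continuous_intros)
  have "continuous_on ({0..1} \<times> {0..1})
       (\<lambda>x. if i = l then 1 else if l = j then of_real (1 - fst x) * w (snd x) i else 0)" for i l
    by (cases "i = l"; cases "l = j") (auto intro!: continuous_intros *)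
  then show "continuous_on ({0..1} \<times> {0..1})
       (\<lambda>x. column_transvection j (\<lambda>l. complex_of_real (1 - fst x) * w (snd x) l))"
    unfolding column_transvection_def by (intro continuous_on_vec_lambda)
qed (simp_all add: det_column_transvection assms(2), simp_all add: column_transvection_def mat_def vec_eq_iff)

text \<open>
  Differentiability is what makes a generic constant avoid the values of a curve in the plane.
  The derivatives need not match at the two ends.
\<close>

definition smooth_loop :: "(real \<Rightarrow> complex) \<Rightarrow> bool" where
  "smooth_loop f \<longleftrightarrow> f differentiable_on {0..1} \<and> f 0 = f 1"

lemma smooth_loop_const [intro]: "smooth_loop (\<lambda>t. c)"
  by (simp add: smooth_loop_def)

lemma smooth_loop_add [intro]: "smooth_loop f \<Longrightarrow> smooth_loop g \<Longrightarrow> smooth_loop (\<lambda>t. f t + g t)"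
  by (auto simp: smooth_loop_def)

lemma smooth_loop_minus [intro]: "smooth_loop f \<Longrightarrow> smooth_loop (\<lambda>t. - f t)"
  by (auto simp: smooth_loop_def)

lemma smooth_loop_diff [intro]: "smooth_loop f \<Longrightarrow> smooth_loop g \<Longrightarrow> smooth_loop (\<lambda>t. f t - g t)"
  by (auto simp: smooth_loop_def)

lemma smooth_loop_mult [intro]: "smooth_loop f \<Longrightarrow> smooth_loop g \<Longrightarrow> smooth_loop (\<lambda>t. f t * g t)"
  by (auto simp: smooth_loop_def differentiable_on_def)

lemma differentiable_on_divide:
  fixes f g :: "real \<Rightarrow> complex"
  assumes "f differentiable_on S" "g differentiable_on S" "\<And>t. t \<in> S \<Longrightarrow> g t \<noteq> 0"
  shows "(\<lambda>t. f t / g t) differentiable_on S"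
  unfolding divide_inverse
  using assms by (auto simp: differentiable_on_def)

lemma smooth_loop_divide [intro]:
  "smooth_loop f \<Longrightarrow> smooth_loop g \<Longrightarrow> (\<And>t. t \<in> {0..1} \<Longrightarrow> g t \<noteq> 0) \<Longrightarrow> smooth_loop (\<lambda>t. f t / g t)"
  unfolding smooth_loop_def by (auto intro: differentiable_on_divide)

lemma smooth_loop_sum [intro]: "(\<And>i. i \<in> I \<Longrightarrow> smooth_loop (f i)) \<Longrightarrow> smooth_loop (\<lambda>t. \<Sum>i\<in>I. f i t)"
  by (induction I rule: infinite_finite_induct) auto

lemma smooth_loop_prod [intro]: "(\<And>i. i \<in> I \<Longrightarrow> smooth_loop (f i)) \<Longrightarrow> smooth_loop (\<lambda>t. \<Prod>i\<in>I. f i t)"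
  by (induction I rule: infinite_finite_induct) auto

lemma smooth_loop_continuous: "smooth_loop f \<Longrightarrow> continuous_on {0..1} f"
  by (simp add: smooth_loop_def differentiable_imp_continuous_on)

text \<open>
  A bad \<open>z\<close> is a value of the differentiable curve \<open>- f / g\<close>, and these values form a null set
  in the plane.
\<close>

lemma generic_combination:
  assumes "f differentiable_on {0..1}" "g differentiable_on {0..1}"
  obtains z :: complex where "\<And>t::real. t \<in> {0..1} \<Longrightarrow> f t + z * g t = 0 \<Longrightarrow> g t = 0"
proof -
  define T where "T = {t \<in> {0..1::real}. g t \<noteq> 0}"
  have "(\<lambda>t. - f t / g t) differentiable_on T"
    by (intro differentiable_on_divide differentiable_on_minus differentiable_on_subset[OF assms(1)]
        differentiable_on_subset[OF assms(2)]) (auto simp: T_def)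
  then have "negligible ((\<lambda>t. - f t / g t) ` T)"
    by (intro negligible_differentiable_image_lowdim) auto
  then obtain z where z: "z \<notin> (\<lambda>t. - f t / g t) ` T"
    using non_negligible_UNIV by (metis UNIV_eq_I)
  have "g t = 0" if "t \<in> {0..1}" "f t + z * g t = 0" for t
  proof (rule ccontr)
    assume "g t \<noteq> 0"
    then have "z = - f t / g t" using that(2) by (simp add: field_simps eq_neg_iff_add_eq_0)
    then show False using z that(1) \<open>g t \<noteq> 0\<close> by (auto simp: T_def)
  qed
  then show ?thesis by (rule that)
qed

text \<open>
  Adding one function at a time with a generic constant makes no common zero appear that was not
  there before, so in the end the combination vanishes only where all the functions do.
\<close>

lemma generic_pivot:
  assumes "finite F" "smooth_loop b" "\<And>i. i \<in> F \<Longrightarrow> smooth_loop (a i)"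
  shows "\<exists>c. \<forall>t\<in>{0..1}. b t + (\<Sum>i\<in>F. c i * a i t) = 0 \<longrightarrow> b t = 0 \<and> (\<forall>i\<in>F. a i t = 0)"
  using assms
proof (induction F rule: finite_induct)
  case empty
  then show ?case by simp
next
  case (insert x F)
  have "\<exists>c. \<forall>t\<in>{0..1}. b t + (\<Sum>i\<in>F. c i * a i t) = 0 \<longrightarrow> b t = 0 \<and> (\<forall>i\<in>F. a i t = 0)"
    by (rule insert.IH) (use insert.prems in auto)
  then obtain c where c: "\<And>t. t \<in> {0..1} \<Longrightarrow> b t + (\<Sum>i\<in>F. c i * a i t) = 0 \<Longrightarrow> b t = 0 \<and> (\<forall>i\<in>F. a i t = 0)"
    by blast
  have "smooth_loop (\<lambda>t. b t + (\<Sum>i\<in>F. c i * a i t))"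
    by (intro smooth_loop_add smooth_loop_sum smooth_loop_mult smooth_loop_const)
      (use insert.prems in auto)
  then obtain z where z: "\<And>t. t \<in> {0..1} \<Longrightarrow> (b t + (\<Sum>i\<in>F. c i * a i t)) + z * a x t = 0 \<Longrightarrow> a x t = 0"
    using generic_combination[of "\<lambda>t. b t + (\<Sum>i\<in>F. c i * a i t)" "a x"] insert.prems(2)[of x]
    unfolding smooth_loop_def by blast
  have expand: "b t + (\<Sum>i\<in>insert x F. (c(x := z)) i * a i t) = (b t + (\<Sum>i\<in>F. c i * a i t)) + z * a x t" for t
  proof -
    have "(\<Sum>i\<in>F. (c(x := z)) i * a i t) = (\<Sum>i\<in>F. c i * a i t)"
      using insert.hyps by (intro sum.cong) auto
    then show ?thesis using insert.hyps by simp
  qed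
  show ?case
  proof (intro exI[of _ "c(x := z)"] ballI impI)
    fix t :: real
    assume t: "t \<in> {0..1}" and 0: "b t + (\<Sum>i\<in>insert x F. (c(x := z)) i * a i t) = 0"
    then have x: "a x t = 0" using z[OF t] by (simp only: expand)
    then have "b t + (\<Sum>i\<in>F. c i * a i t) = 0" using 0 by (simp only: expand) simp
    then show "b t = 0 \<and> (\<forall>i\<in>insert x F. a i t = 0)" using c[OF t] x by simp
  qed
qed

definition smooth_matrix_loop :: "(real \<Rightarrow> complex^'n^'n) \<Rightarrow> bool" where
  "smooth_matrix_loop A \<longleftrightarrow> (\<forall>i j. smooth_loop (\<lambda>t. A t $ i $ j))"

lemma smooth_matrix_loop_mult:
  "smooth_matrix_loop A \<Longrightarrow> smooth_matrix_loop B \<Longrightarrow> smooth_matrix_loop (\<lambda>t. A t ** B t)"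
  unfolding smooth_matrix_loop_def matrix_matrix_mult_def vec_lambda_beta
  by (intro allI smooth_loop_sum smooth_loop_mult) auto

lemma smooth_row_transvection:
  assumes "\<And>l. smooth_loop (\<lambda>t. w t l)"
  shows "smooth_matrix_loop (\<lambda>t. row_transvection j (w t))"
proof -
  have "smooth_loop (\<lambda>t. if i = l then 1 else if i = j then w t l else 0)" for i l
    using assms by (cases "i = l"; cases "i = j") auto
  then show ?thesis by (simp add: smooth_matrix_loop_def row_transvection_def)
qed

lemma smooth_column_transvection:
  assumes "\<And>l. smooth_loop (\<lambda>t. w t l)"
  shows "smooth_matrix_loop (\<lambda>t. column_transvection j (w t))"
proof -
  have "smooth_loop (\<lambda>t. if i = l then 1 else if l = j then w t i else 0)" for i l
    using assms by (cases "i = l"; cases "l = j") auto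
  then show ?thesis by (simp add: smooth_matrix_loop_def column_transvection_def)
qed

lemma smooth_loop_family:
  assumes "\<And>l. smooth_loop (\<lambda>t. w t l)"
  shows "\<And>l. continuous_on {0..1} (\<lambda>t. - w t l)" "(\<lambda>l. - w 0 l) = (\<lambda>l. - w 1 l)"
  using assms smooth_loop_continuous by (auto simp: smooth_loop_def intro!: continuous_on_minus)

lemma nullhomotopic_cancel_row_left:
  assumes w: "\<And>l. smooth_loop (\<lambda>t. w t l)" and N: "nullhomotopic_loop (\<lambda>t. row_transvection j (w t) ** A t)"
  shows "nullhomotopic_loop A"
  using nullhomotopic_loop_mult[OF nullhomotopic_row_transvection[OF smooth_loop_family[of w, OF w], where j = j] N]
  by (simp add: matrix_mul_assoc row_transvection_inverse)

lemma nullhomotopic_cancel_column_left: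
  assumes w: "\<And>l. smooth_loop (\<lambda>t. w t l)" and N: "nullhomotopic_loop (\<lambda>t. column_transvection j (w t) ** A t)"
  shows "nullhomotopic_loop A"
  using nullhomotopic_loop_mult[OF nullhomotopic_column_transvection[OF smooth_loop_family[of w, OF w], where j = j] N]
  by (simp add: matrix_mul_assoc column_transvection_inverse)

lemma nullhomotopic_cancel_row_right:
  assumes w: "\<And>l. smooth_loop (\<lambda>t. w t l)" and N: "nullhomotopic_loop (\<lambda>t. A t ** row_transvection j (w t))"
  shows "nullhomotopic_loop A"
proof -
  have "row_transvection j (w t) ** row_transvection j (\<lambda>l. - w t l) = mat 1" for t
    using row_transvection_inverse[of j "\<lambda>l. - w t l"] by simp
  then show ?thesis
    using nullhomotopic_loop_mult[OF N nullhomotopic_row_transvection[OF smooth_loop_family[of w, OF w], where j = j]]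
    by (simp add: matrix_mul_assoc[symmetric])
qed

text \<open>
  Square matrices with indices in \<open>S\<close>, extended by the identity to the whole index type. This
  allows an induction on the size of a matrix without a change of type.
\<close>

definition supported_on :: "'n set \<Rightarrow> complex^'n^'n \<Rightarrow> bool" where
  "supported_on S A \<longleftrightarrow> (\<forall>i j. i \<notin> S \<or> j \<notin> S \<longrightarrow> A $ i $ j = (if i = j then 1 else 0))"

lemma supported_on_row_transvection_mult:
  assumes "supported_on S A" "j \<in> S" "\<And>l. l \<notin> S \<Longrightarrow> w l = 0"
  shows "supported_on S (row_transvection j w ** A)"
proof -
  have "(\<Sum>m\<in>-{j}. w m * A $ m $ l) = 0" if "l \<notin> S" for l
  proof (rule sum.neutral, rule ballI)
    fix m
    show "w m * A $ m $ l = 0"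
      using assms(1,3) that unfolding supported_on_def by (cases "m \<in> S") auto
  qed
  then show ?thesis
    using assms unfolding supported_on_def row_transvection_mult by auto
qed

text \<open>
  Each step multiplies by a loop of transvections, which is null-homotopic and can be undone. One
  such step makes the pivot \<open>A\<^sub>j\<^sub>j\<close> nonzero everywhere. While a second index \<open>l\<close> is left, the pivot
  can be made equal to \<open>1\<close>: a multiple of row \<open>j\<close> turns \<open>A\<^sub>l\<^sub>j\<close> into \<open>1 - A\<^sub>j\<^sub>j\<close>, after which row \<open>l\<close>
  is added to row \<open>j\<close>. Then column \<open>j\<close> and row \<open>j\<close> are cleared and \<open>j\<close> leaves the set \<open>S\<close>. In
  the end \<open>S = {j}\<close>, and the determinant forces \<open>A\<^sub>j\<^sub>j = 1\<close>.
\<close>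

lemma nullhomotopic_by_elimination:
  fixes A :: "real \<Rightarrow> complex^'n^'n"
  assumes "finite S" "S \<noteq> {}" "smooth_matrix_loop A"
    and "\<And>t. t \<in> {0..1} \<Longrightarrow> det (A t) = 1" "\<And>t. t \<in> {0..1} \<Longrightarrow> supported_on S (A t)"
  shows "nullhomotopic_loop A"
  using assms
proof (induction "card S" arbitrary: S A)
  case 0
  then show ?case by simp
next
  case (Suc n)
  note smooth = \<open>smooth_matrix_loop A\<close>
  note det = \<open>\<And>t. t \<in> {0..1} \<Longrightarrow> det (A t) = 1\<close>
  note supp = \<open>\<And>t. t \<in> {0..1} \<Longrightarrow> supported_on S (A t)\<close>
  obtain j where j: "j \<in> S" using \<open>S \<noteq> {}\<close> by auto
  show ?case
  proof (cases "S = {j}")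
    case True
    have "A t = mat 1" if t: "t \<in> {0..1}" for t
    proof -
      have offdiag: "A t $ i $ l = (if i = l then 1 else 0)" if "i \<noteq> j \<or> l \<noteq> j" for i l
        using supp[OF t] that True by (auto simp: supported_on_def)
      then have "det (A t) = (\<Prod>i\<in>UNIV. A t $ i $ i)"
        by (intro det_diagonal) (metis (full_types))
      also have "\<dots> = A t $ j $ j"
        by (subst prod.remove[of _ j]) (auto simp: offdiag)
      finally have "A t $ i $ l = (if i = l then 1 else 0)" for i l
        using det[OF t] offdiag[of i l] by (cases "i = j \<and> l = j") auto
      then show ?thesis by (simp add: vec_eq_iff mat_def)
    qed
    then show ?thesis
      unfolding nullhomotopic_loop_iff
      by (intro exI[of _ "\<lambda>_. mat 1"]) auto
  next
    case False
    then obtain l where l: "l \<in> S" "l \<noteq> j" using j by auto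
    have entry: "smooth_loop (\<lambda>t. X t $ i $ m)" if "smooth_matrix_loop X" for X :: "real \<Rightarrow> complex^'n^'n" and i m
      using that by (simp add: smooth_matrix_loop_def)
    have "\<exists>c. \<forall>t\<in>{0..1}. A t $ j $ j + (\<Sum>i\<in>S - {j}. c i * A t $ i $ j) = 0 \<longrightarrow>
        A t $ j $ j = 0 \<and> (\<forall>i\<in>S - {j}. A t $ i $ j = 0)"
      by (rule generic_pivot) (use \<open>finite S\<close> entry[OF smooth] in auto)
    then obtain c where c: "\<And>t. t \<in> {0..1} \<Longrightarrow> A t $ j $ j + (\<Sum>i\<in>S - {j}. c i * A t $ i $ j) = 0 \<Longrightarrow>
        A t $ j $ j = 0 \<and> (\<forall>i\<in>S - {j}. A t $ i $ j = 0)"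
      by blast
    (* A1: a pivot without zeros. *)
    define w1 where "w1 i = (if i \<in> S - {j} then c i else 0)" for i
    define A1 where "A1 t = row_transvection j w1 ** A t" for t
    have smooth1: "smooth_matrix_loop A1"
      unfolding A1_def by (intro smooth_matrix_loop_mult smooth_row_transvection smooth smooth_loop_const)
    have det1: "det (A1 t) = 1" if "t \<in> {0..1}" for t
      by (simp add: A1_def det_mul det_row_transvection det[OF that])
    have supp1: "supported_on S (A1 t)" if "t \<in> {0..1}" for t
      unfolding A1_def using supp[OF that] j
      by (intro supported_on_row_transvection_mult) (auto simp: w1_def)
    have pivot: "A1 t $ j $ j \<noteq> 0" if t: "t \<in> {0..1}" for t
    proof
      assume 0: "A1 t $ j $ j = 0"
      have "(\<Sum>i\<in>-{j}. w1 i * A t $ i $ j) = (\<Sum>i\<in>S - {j}. c i * A t $ i $ j)"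
        by (intro sum.mono_neutral_cong_right) (auto simp: w1_def)
      then have "A1 t $ j $ j = A t $ j $ j + (\<Sum>i\<in>S - {j}. c i * A t $ i $ j)"
        by (simp add: A1_def row_transvection_mult)
      then have "A t $ j $ j = 0 \<and> (\<forall>i\<in>S - {j}. A t $ i $ j = 0)"
        using 0 by (intro c[OF t]) metis
      moreover have "A t $ i $ j = 0" if "i \<notin> S" for i
        using supp[OF t] that j by (auto simp: supported_on_def)
      ultimately have "column j (A t) = 0"
        by (auto simp: vec_eq_iff column_def)
      then show False using det_zero_column[of j "A t"] det[OF t] by simp
    qed
    (* A2: the entries (j,j) and (l,j) add up to 1. *)
    define w2 where "w2 t i = (if i = j then (1 - A1 t $ j $ j - A1 t $ l $ j) / A1 t $ j $ j else 0)" for t i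
    have "smooth_loop (\<lambda>t. (1 - A1 t $ j $ j - A1 t $ l $ j) / A1 t $ j $ j)"
      by (intro smooth_loop_divide smooth_loop_diff smooth_loop_const entry[OF smooth1] pivot)
    then have w2: "smooth_loop (\<lambda>t. w2 t i)" for i
      unfolding w2_def by (cases "i = j") auto
    define A2 where "A2 t = row_transvection l (w2 t) ** A1 t" for t
    have smooth2: "smooth_matrix_loop A2"
      unfolding A2_def by (intro smooth_matrix_loop_mult smooth_row_transvection smooth1 w2)
    have det2: "det (A2 t) = 1" if "t \<in> {0..1}" for t
      by (simp add: A2_def det_mul det_row_transvection det1[OF that])
    have supp2: "supported_on S (A2 t)" if "t \<in> {0..1}" for t
      unfolding A2_def using supp1[OF that] j l
      by (intro supported_on_row_transvection_mult) (auto simp: w2_def)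
    have A2: "A2 t $ j $ j + A2 t $ l $ j = 1" if t: "t \<in> {0..1}" for t
    proof -
      have "(\<Sum>m\<in>-{l}. w2 t m * A1 t $ m $ j) = w2 t j * A1 t $ j $ j"
        using l by (subst sum.remove[of _ j]) (auto simp: w2_def)
      then show ?thesis
        using l pivot[OF t] by (simp add: A2_def row_transvection_mult w2_def)
    qed
    (* A3: the pivot is 1. *)
    define w3 where "w3 i = (if i = l then 1 else 0 :: complex)" for i
    define A3 where "A3 t = row_transvection j w3 ** A2 t" for t
    have smooth3: "smooth_matrix_loop A3"
      unfolding A3_def by (intro smooth_matrix_loop_mult smooth_row_transvection smooth2 smooth_loop_const)
    have det3: "det (A3 t) = 1" if "t \<in> {0..1}" for t
      by (simp add: A3_def det_mul det_row_transvection det2[OF that])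
    have supp3: "supported_on S (A3 t)" if "t \<in> {0..1}" for t
      unfolding A3_def using supp2[OF that] j l
      by (intro supported_on_row_transvection_mult) (auto simp: w3_def)
    have A3: "A3 t $ j $ j = 1" if t: "t \<in> {0..1}" for t
    proof -
      have "(\<Sum>m\<in>-{j}. w3 m * A2 t $ m $ j) = A2 t $ l $ j"
        using l by (subst sum.remove[of _ l]) (auto simp: w3_def)
      then show ?thesis
        using A2[OF t] by (simp add: A3_def row_transvection_mult)
    qed
    (* A4 has column j cleared, A5 row j as well. *)
    define A4 where "A4 t = column_transvection j (\<lambda>i. - A3 t $ i $ j) ** A3 t" for t
    have smooth4: "smooth_matrix_loop A4"
      unfolding A4_def
      by (intro smooth_matrix_loop_mult smooth_column_transvection smooth3 smooth_loop_minus entry)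
    have det4: "det (A4 t) = 1" if "t \<in> {0..1}" for t
      by (simp add: A4_def det_mul det_column_transvection det3[OF that])
    have supp4: "supported_on S (A4 t)" if t: "t \<in> {0..1}" for t
      using supp3[OF t] j unfolding supported_on_def A4_def column_transvection_mult by auto
    have A4: "A4 t $ i $ j = (if i = j then 1 else 0)" if t: "t \<in> {0..1}" for t i
      using A3[OF t] by (simp add: A4_def column_transvection_mult)
    define A5 where "A5 t = A4 t ** row_transvection j (\<lambda>m. - A4 t $ j $ m)" for t
    have smooth5: "smooth_matrix_loop A5"
      unfolding A5_def
      by (intro smooth_matrix_loop_mult smooth_row_transvection smooth4 smooth_loop_minus entry)
    have det5: "det (A5 t) = 1" if "t \<in> {0..1}" for t
      by (simp add: A5_def det_mul det_row_transvection det4[OF that])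
    have supp5: "supported_on (S - {j}) (A5 t)" if t: "t \<in> {0..1}" for t
      using supp4[OF t] A4[OF t] j unfolding supported_on_def A5_def mult_row_transvection by auto
    have "nullhomotopic_loop A5"
    proof (rule Suc.hyps(1)[of "S - {j}"])
      show "n = card (S - {j})" using Suc.hyps(2) j by simp
      show "S - {j} \<noteq> {}" using l by blast
    qed (use \<open>finite S\<close> smooth5 det5 supp5 in auto)
    then have "nullhomotopic_loop A4"
      unfolding A5_def
      by (rule nullhomotopic_cancel_row_right[rotated]) (intro smooth_loop_minus entry[OF smooth4])
    then have "nullhomotopic_loop A3"
      unfolding A4_def
      by (rule nullhomotopic_cancel_column_left[rotated]) (intro smooth_loop_minus entry[OF smooth3])
    then have "nullhomotopic_loop A2"
      unfolding A3_def by (rule nullhomotopic_cancel_row_left[rotated]) (rule smooth_loop_const)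
    then have "nullhomotopic_loop A1"
      unfolding A2_def by (rule nullhomotopic_cancel_row_left[rotated]) (rule w2)
    then show ?thesis
      unfolding A1_def by (rule nullhomotopic_cancel_row_left[rotated]) (rule smooth_loop_const)
  qed
qed

lemma nullhomotopic_smooth_loop:
  fixes A :: "real \<Rightarrow> complex^'n^'n"
  assumes "smooth_matrix_loop A" "\<And>t. t \<in> {0..1} \<Longrightarrow> det (A t) = 1"
  shows "nullhomotopic_loop A"
  by (rule nullhomotopic_by_elimination[of UNIV]) (use assms in \<open>auto simp: supported_on_def\<close>)

definition scale_row :: "'n \<Rightarrow> complex \<Rightarrow> complex^'n^'n \<Rightarrow> complex^'n^'n" where
  "scale_row j z A = (\<chi> i. if i = j then z *s A $ i else A $ i)"

lemma det_scale_row: "det (scale_row j z A) = z * det A"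
proof -
  have "(\<chi> i. if i = j then A $ j else A $ i) = A"
    by (simp add: vec_eq_iff)
  then show ?thesis
    unfolding scale_row_def using det_row_mul[of j z "\<lambda>_. A $ j" "\<lambda>i. A $ i"]
    by (simp cong: if_cong)
qed

lemma scale_row_scale_row [simp]: "scale_row j z (scale_row j w A) = scale_row j (z * w) A"
  by (simp add: scale_row_def vec_eq_iff)

lemma scale_row_one [simp]: "scale_row j 1 A = A"
  by (simp add: scale_row_def vec_eq_iff)

lemma continuous_on_scale_row:
  fixes f :: "'a::topological_space \<Rightarrow> complex" and g :: "'a \<Rightarrow> complex^'n^'n"
  assumes "continuous_on S f" "continuous_on S g"
  shows "continuous_on S (\<lambda>x. scale_row j (f x) (g x))"
  unfolding scale_row_def
proof (rule continuous_on_vec_lambda)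
  fix i
  have "continuous_on S (\<lambda>x. \<chi> l. f x * g x $ i $ l)"
    by (intro continuous_intros assms)
  then show "continuous_on S (\<lambda>x. if i = j then f x *s g x $ i else g x $ i)"
    using assms(2) by (cases "i = j") (auto simp: vector_scalar_mult_def intro: continuous_on_component)
qed

definition normalise_row :: "'n \<Rightarrow> complex^'n^'n \<Rightarrow> complex^'n^'n" where
  "normalise_row j A = scale_row j (1 / det A) A"

lemma det_normalise_row: "det A \<noteq> 0 \<Longrightarrow> det (normalise_row j A) = 1"
  by (simp add: normalise_row_def det_scale_row)

lemma continuous_on_normalise_row:
  assumes "continuous_on S g" "\<And>x. x \<in> S \<Longrightarrow> det (g x) \<noteq> 0"
  shows "continuous_on S (\<lambda>x. normalise_row j (g x))"
  unfolding normalise_row_def using assms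
  by (intro continuous_on_scale_row continuous_on_divide continuous_on_const continuous_on_det) auto

text \<open>
  A polynomial loop close to \<open>g\<close> stays invertible and is homotopic to \<open>g\<close> through invertible
  matrices. Dividing a row by the determinant retracts the invertible matrices onto \<open>SL\<^sub>n\<close>; it
  leaves \<open>g\<close> fixed and carries the homotopy into \<open>SL\<^sub>n\<close>.
\<close>

lemma special_linear_nearby_smooth:
  fixes g :: "real \<Rightarrow> complex^'n^'n"
  assumes g: "path g" "path_image g \<subseteq> special_linear" "pathfinish g = pathstart g"
  obtains p where "smooth_matrix_loop p" "\<And>t. t \<in> {0..1} \<Longrightarrow> det (p t) = 1" "homotopic_loops special_linear g p"
proof -
  let ?GL = "general_linear :: (complex^'n^'n) set"
  have "compact (path_image g)" "closed (- ?GL)" "path_image g \<inter> - ?GL = {}"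
    using g open_general_linear by (auto simp: compact_path_image general_linear_eq special_linear_def)
  then obtain e where e: "e > 0" "\<And>x y. x \<in> path_image g \<Longrightarrow> y \<notin> ?GL \<Longrightarrow> e \<le> dist x y"
    using separate_compact_closed by (metis ComplI)
  obtain q where q: "polynomial_function q" "pathstart q = pathstart g" "pathfinish q = pathfinish g"
    and near: "\<And>t. t \<in> {0..1} \<Longrightarrow> norm (q t - g t) < e"
    using path_approx_polynomial_function[OF g(1) e(1)] by metis
  have "path q" using q(1) by (simp add: path_polynomial_function)
  have hom: "homotopic_loops ?GL g q"
  proof (rule homotopic_loops_nearby_explicit)
    fix t :: real and x assume "t \<in> {0..1}" "x \<notin> ?GL"
    then show "norm (q t - g t) < norm (g t - x)"
      using near[of t] e(2)[of "g t" x] by (auto simp: path_image_def dist_norm)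
  qed (use g q \<open>path q\<close> in auto)
  then have q_GL: "det (q t) \<noteq> 0" if "t \<in> {0..1}" for t
    using homotopic_loops_imp_subset[OF hom] that by (simp add: path_image_def general_linear_eq image_subset_iff)
  (* The row to be divided by the determinant, chosen arbitrarily. *)
  obtain j :: 'n where True by simp
  define p where "p = normalise_row j \<circ> q"
  have entry: "smooth_loop (\<lambda>t. q t $ i $ l)" for i l
  proof -
    have "bounded_linear (\<lambda>A :: complex^'n^'n. A $ i $ l)"
      by (rule bounded_linear_compose[OF bounded_linear_vec_nth bounded_linear_vec_nth])
    then have "polynomial_function (\<lambda>t. q t $ i $ l)"
      using q(1) bounded_linear_compose[of _ "\<lambda>A :: complex^'n^'n. A $ i $ l"]
      unfolding polynomial_function_def o_def by blast
    then show ?thesis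
      using q(2,3) g(3)
      by (auto simp: smooth_loop_def pathstart_def pathfinish_def differentiable_on_polynomial_function)
  qed
  have det_q: "smooth_loop (\<lambda>t. det (q t))"
    unfolding det_def
    by (intro smooth_loop_sum smooth_loop_mult smooth_loop_const smooth_loop_prod entry)
  have smooth_p: "smooth_loop (\<lambda>t. p t $ i $ l)" for i l
  proof (cases "i = j")
    case True
    then show ?thesis
      using smooth_loop_mult[OF smooth_loop_divide[OF smooth_loop_const[of 1] det_q] entry] q_GL
      by (simp add: p_def normalise_row_def scale_row_def)
  next
    case False
    then show ?thesis using entry by (simp add: p_def normalise_row_def scale_row_def)
  qed
  have cont: "continuous_on ?GL (normalise_row j)"
    using continuous_on_normalise_row[OF continuous_on_id, of general_linear j] by (simp add: general_linear_eq)
  have "homotopic_loops special_linear (normalise_row j \<circ> g) (normalise_row j \<circ> q)"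
    by (rule homotopic_loops_continuous_image[OF hom cont])
      (auto simp: special_linear_def det_normalise_row general_linear_eq)
  moreover have "homotopic_loops special_linear g (normalise_row j \<circ> g)"
  proof (rule homotopic_loops_eq[OF g])
    fix t :: real assume "t \<in> {0..1}"
    then have "det (g t) = 1" using g(2) by (simp add: path_image_def special_linear_def image_subset_iff)
    then show "g t = (normalise_row j \<circ> g) t"
      by (simp add: normalise_row_def)
  qed
  ultimately have "homotopic_loops special_linear g p"
    using homotopic_loops_trans unfolding p_def by blast
  moreover have "det (p t) = 1" if "t \<in> {0..1}" for t
    by (simp add: p_def det_normalise_row q_GL[OF that])
  moreover have "smooth_matrix_loop p" using smooth_p by (simp add: smooth_matrix_loop_def)
  ultimately show ?thesis using that by blast
qed

theorem simply_connected_special_linear: "simply_connected (special_linear :: (complex^'n^'n) set)"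
  unfolding simply_connected_eq_contractible_loop_any
proof (intro allI impI)
  fix p :: "real \<Rightarrow> complex^'n^'n" and a :: "complex^'n^'n"
  assume p: "path p \<and> path_image p \<subseteq> special_linear \<and> pathfinish p = pathstart p \<and> a \<in> special_linear"
  then obtain q where q: "smooth_matrix_loop q" "\<And>t. t \<in> {0..1} \<Longrightarrow> det (q t) = 1" "homotopic_loops special_linear p q"
    using special_linear_nearby_smooth by metis
  have "nullhomotopic_loop q" using nullhomotopic_smooth_loop q by blast
  moreover have "nullhomotopic_loop (\<lambda>_. a)"
    using p by (intro nullhomotopic_smooth_loop) (auto simp: special_linear_def smooth_matrix_loop_def)
  moreover have "linepath a a = (\<lambda>_. a)"
    by (auto simp: linepath_def algebra_simps)
  ultimately show "homotopic_loops special_linear p (linepath a a)"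
    using q(3) homotopic_loops_trans homotopic_loops_sym unfolding nullhomotopic_loop_def by metis
qed

section \<open>Homotopy groups of products\<close>

lemma topology_eq_continuous_id:
  assumes "continuous_map X Y id" "continuous_map Y X id" "topspace X = topspace Y"
  shows "X = Y"
  unfolding topology_eq
  using assms topology_finer_continuous_id[of X Y] topology_finer_continuous_id[of Y X] by auto

lemma topspace_cube: "topspace (cube n) = (\<Pi>\<^sub>E i\<in>{..<n}. {0..1})"
  by (simp add: cube_def)

text \<open>
  Points of the cube are functions on all natural numbers with the default value \<open>undefined\<close> from
  \<open>n\<close> on. This description makes continuity on the cube the continuity of functions on a
  subset of a metric space.
\<close>

lemma cube_eq_top_of_set: "cube n = top_of_set (topspace (cube n))"
proof (rule topology_eq_continuous_id)
  show "continuous_map (cube n) (top_of_set (topspace (cube n))) id"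
  proof -
    have "continuous_map (cube n) (product_topology (\<lambda>_. euclideanreal) UNIV) id"
      unfolding continuous_map_componentwise_UNIV
    proof
      fix i
      show "continuous_map (cube n) euclideanreal (\<lambda>x. id x i)"
      proof (cases "i < n")
        case True
        then have "continuous_map (cube n) (top_of_set {0..1::real}) (\<lambda>x. x i)"
          unfolding cube_def by (intro continuous_map_product_coordinates) auto
        then show ?thesis by (simp add: continuous_map_in_subtopology)
      next
        case False
        then have "continuous_map (cube n) euclideanreal (\<lambda>x. undefined)"
          by simp
        then show ?thesis
          by (rule continuous_map_eq) (use False in \<open>auto simp: topspace_cube PiE_def extensional_def\<close>)
      qed
    qed
    then show ?thesis
      unfolding euclidean_product_topology by (simp add: continuous_map_in_subtopology)
  qed
  show "continuous_map (top_of_set (topspace (cube n))) (cube n) id"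
    unfolding cube_def continuous_map_componentwise
  proof (intro conjI ballI)
    show "id ` topspace (top_of_set (topspace (product_topology (\<lambda>_. top_of_set {0..1::real}) {..<n}))) \<subseteq> extensional {..<n}"
      by (auto simp: PiE_def)
    fix i assume "i \<in> {..<n}"
    moreover have "continuous_on S (\<lambda>x. x i)" for S :: "(nat \<Rightarrow> real) set"
      by (rule continuous_on_subset[OF continuous_on_product_coordinates]) simp
    ultimately show "continuous_map (top_of_set (topspace (product_topology (\<lambda>_. top_of_set {0..1::real}) {..<n})))
        (top_of_set {0..1}) (\<lambda>x. id x i)"
      by (auto simp: continuous_map_in_subtopology)
  qed
qed auto

lemma cube_boundary_subset: "cube_boundary n \<subseteq> topspace (cube n)"
  by (auto simp: cube_boundary_def)

lemma homotopic_spheroids_iff: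
  "homotopic_spheroids n X a f g \<longleftrightarrow>
    (\<exists>h. continuous_map (prod_topology (top_of_set {0..1::real}) (cube n)) X h \<and>
      (\<forall>t\<in>topspace (cube n). h (0, t) = f t) \<and> (\<forall>t\<in>topspace (cube n). h (1, t) = g t) \<and>
      (\<forall>s\<in>{0..1}. \<forall>t\<in>cube_boundary n. h (s, t) = a))"
  unfolding homotopic_spheroids_def
  by (rule homotopic_with) (use cube_boundary_subset in \<open>auto simp: subset_iff\<close>)

lemma homotopic_spheroids_refl: "homotopic_spheroids n X a f f \<longleftrightarrow> spheroid n X a f"
  by (simp add: homotopic_spheroids_def spheroid_def)

lemma homotopic_spheroids_sym: "homotopic_spheroids n X a f g \<Longrightarrow> homotopic_spheroids n X a g f"
  unfolding homotopic_spheroids_def by (rule homotopic_with_symD)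

lemma homotopic_spheroids_trans:
  "homotopic_spheroids n X a f g \<Longrightarrow> homotopic_spheroids n X a g h \<Longrightarrow> homotopic_spheroids n X a f h"
  unfolding homotopic_spheroids_def by (rule homotopic_with_trans)

lemma homotopic_spheroids_imp_spheroid:
  "homotopic_spheroids n X a f g \<Longrightarrow> spheroid n X a f \<and> spheroid n X a g"
  unfolding homotopic_spheroids_def spheroid_def
  using homotopic_with_imp_continuous_maps homotopic_with_imp_property by blast

lemma spheroid_in_topspace: "spheroid n X a f \<Longrightarrow> t \<in> topspace (cube n) \<Longrightarrow> f t \<in> topspace X"
  unfolding spheroid_def using continuous_map_image_subset_topspace by blast

lemma homotopic_spheroids_eq:
  "spheroid n X a f \<Longrightarrow> (\<And>t. t \<in> topspace (cube n) \<Longrightarrow> f t = g t) \<Longrightarrow> homotopic_spheroids n X a f g"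
  unfolding homotopic_spheroids_def spheroid_def
  by (rule homotopic_with_equal) (use cube_boundary_subset in \<open>auto simp: subset_iff\<close>)

lemma rescale_in_cube:
  assumes "n \<ge> 1" "t \<in> topspace (cube n)"
  shows "t 0 \<le> 1/2 \<Longrightarrow> t(0 := 2 * t 0) \<in> topspace (cube n)"
    and "1/2 \<le> t 0 \<Longrightarrow> t(0 := 2 * t 0 - 1) \<in> topspace (cube n)"
proof -
  have t: "\<And>i. i < n \<Longrightarrow> 0 \<le> t i \<and> t i \<le> 1" "\<And>i. \<not> i < n \<Longrightarrow> t i = undefined"
    using assms by (auto simp: topspace_cube PiE_iff extensional_def)
  show "t 0 \<le> 1/2 \<Longrightarrow> t(0 := 2 * t 0) \<in> topspace (cube n)"
    and "1/2 \<le> t 0 \<Longrightarrow> t(0 := 2 * t 0 - 1) \<in> topspace (cube n)"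
    using t(1)[of 0] t assms(1) by (auto simp: topspace_cube PiE_iff extensional_def)
qed

lemma rescale_in_boundary:
  assumes "n \<ge> 1" "t \<in> cube_boundary n"
  shows "t 0 \<le> 1/2 \<Longrightarrow> t(0 := 2 * t 0) \<in> cube_boundary n"
    and "\<not> t 0 \<le> 1/2 \<Longrightarrow> t(0 := 2 * t 0 - 1) \<in> cube_boundary n"
proof -
  have t: "t \<in> topspace (cube n)" "\<exists>i<n. t i = 0 \<or> t i = 1"
    using assms by (auto simp: cube_boundary_def)
  then obtain i where i: "i < n" "t i = 0 \<or> t i = 1" by blast
  show "t(0 := 2 * t 0) \<in> cube_boundary n" if "t 0 \<le> 1/2"
  proof -
    have "t(0 := 2 * t 0) \<in> topspace (cube n)"
      by (rule rescale_in_cube(1)[OF assms(1) t(1) that])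
    moreover have "(t(0 := 2 * t 0)) i = 0 \<or> (t(0 := 2 * t 0)) i = 1"
      using i that by (cases "i = 0") auto
    ultimately show ?thesis
      unfolding cube_boundary_def mem_Collect_eq using i(1) by blast
  qed
  show "t(0 := 2 * t 0 - 1) \<in> cube_boundary n" if "\<not> t 0 \<le> 1/2"
  proof -
    have "t(0 := 2 * t 0 - 1) \<in> topspace (cube n)"
      by (rule rescale_in_cube(2)[OF assms(1) t(1)]) (use that in simp)
    moreover have "(t(0 := 2 * t 0 - 1)) i = 0 \<or> (t(0 := 2 * t 0 - 1)) i = 1"
      using i that by (cases "i = 0") auto
    ultimately show ?thesis
      unfolding cube_boundary_def mem_Collect_eq using i(1) by blast
  qed
qed

lemma continuous_map_rescale:
  fixes c :: real
  assumes "\<And>t. t \<in> topspace (cube n) \<Longrightarrow> P t \<Longrightarrow> t(0 := 2 * t 0 - c) \<in> topspace (cube n)"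
  shows "continuous_map
    (subtopology (prod_topology (top_of_set {0..1::real}) (cube n)) {x. x \<in> topspace (prod_topology (top_of_set {0..1::real}) (cube n)) \<and> P (snd x)})
    (prod_topology (top_of_set {0..1::real}) (cube n)) (\<lambda>(s, t). (s, t(0 := 2 * t 0 - c)))"
proof -
  let ?C = "topspace (cube n)"
  have eq: "prod_topology (top_of_set {0..1::real}) (cube n) = top_of_set ({0..1} \<times> ?C)"
    by (subst cube_eq_top_of_set) simp
  have cont: "continuous_on D (\<lambda>(s, t). (s, t(0 := 2 * t 0 - c)))" for D :: "(real \<times> (nat \<Rightarrow> real)) set"
    unfolding case_prod_beta
  proof (intro continuous_on_Pair continuous_on_fst continuous_on_id continuous_on_coordinatewise_then_product)
    fix i :: nat
    have "continuous_on D (\<lambda>x. snd x i)" for i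
      by (rule continuous_on_product_then_coordinatewise[OF continuous_on_snd[OF continuous_on_id]])
    then show "continuous_on D (\<lambda>x. ((snd x)(0 := 2 * snd x 0 - c)) i)"
      by (cases "i = 0") (auto intro!: continuous_intros)
  qed
  show ?thesis
    unfolding eq using assms
    by (auto simp: subtopology_subtopology continuous_map_in_subtopology intro!: cont)
qed

text \<open>
  The two homotopies are concatenated at each time. On the wall where coordinate \<open>0\<close> is \<open>1/2\<close>
  both are evaluated on the boundary of the cube and give \<open>a\<close>.
\<close>

lemma homotopic_spheroids_concat:
  assumes n: "n \<ge> 1" and "homotopic_spheroids n X a f f'" "homotopic_spheroids n X a g g'"
  shows "homotopic_spheroids n X a (spheroid_concat f g) (spheroid_concat f' g')"
proof -
  let ?D = "prod_topology (top_of_set {0..1::real}) (cube n)"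
  obtain h where h: "continuous_map ?D X h" "\<forall>t\<in>topspace (cube n). h (0, t) = f t"
    "\<forall>t\<in>topspace (cube n). h (1, t) = f' t" "\<forall>s\<in>{0..1}. \<forall>t\<in>cube_boundary n. h (s, t) = a"
    using assms(2) unfolding homotopic_spheroids_iff by blast
  obtain k where k: "continuous_map ?D X k" "\<forall>t\<in>topspace (cube n). k (0, t) = g t"
    "\<forall>t\<in>topspace (cube n). k (1, t) = g' t" "\<forall>s\<in>{0..1}. \<forall>t\<in>cube_boundary n. k (s, t) = a"
    using assms(3) unfolding homotopic_spheroids_iff by blast
  define H where "H x = (if snd x 0 \<le> 1/2 then (h \<circ> (\<lambda>(s, t). (s, t(0 := 2 * t 0 - 0)))) x
    else (k \<circ> (\<lambda>(s, t). (s, t(0 := 2 * t 0 - 1)))) x)" for x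
  have "continuous_map ?D X H"
    unfolding H_def
  proof (rule continuous_map_cases_le)
    have eq: "?D = top_of_set ({0..1} \<times> topspace (cube n))"
      by (subst cube_eq_top_of_set) simp
    show "continuous_map ?D euclideanreal (\<lambda>x. snd x 0)"
      unfolding eq
      by (simp add: continuous_on_product_then_coordinatewise[OF continuous_on_snd[OF continuous_on_id]])
    show "continuous_map ?D euclideanreal (\<lambda>x. 1/2)" by simp
    show "continuous_map (subtopology ?D {x \<in> topspace ?D. snd x 0 \<le> 1/2}) X
        (h \<circ> (\<lambda>(s, t). (s, t(0 := 2 * t 0 - 0))))"
      by (rule continuous_map_compose[OF continuous_map_rescale h(1)])
        (use rescale_in_cube(1)[OF n] in simp)
    show "continuous_map (subtopology ?D {x \<in> topspace ?D. 1/2 \<le> snd x 0}) X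
        (k \<circ> (\<lambda>(s, t). (s, t(0 := 2 * t 0 - 1))))"
      by (rule continuous_map_compose[OF continuous_map_rescale k(1)])
        (use rescale_in_cube(2)[OF n] in simp)
    fix x
    assume x: "x \<in> topspace ?D" "snd x 0 = 1/2"
    obtain s t where st: "x = (s, t)" by (cases x)
    then have s: "s \<in> {0..1}" and t: "t \<in> topspace (cube n)" "t 0 = 1/2"
      using x by auto
    have "t(0 := 1) \<in> topspace (cube n)" "t(0 := 0) \<in> topspace (cube n)"
      using rescale_in_cube[OF n t(1)] t(2) by simp_all
    then have "t(0 := 1) \<in> cube_boundary n" "t(0 := 0) \<in> cube_boundary n"
      using n unfolding cube_boundary_def by (auto intro!: exI[of _ 0])
    then have "h (s, t(0 := 1)) = k (s, t(0 := 0))"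
      using h(4) k(4) s by simp
    moreover have "2 * t 0 - 0 = 1" "2 * t 0 - 1 = 0"
      using t(2) by linarith+
    ultimately show "(h \<circ> (\<lambda>(s, t). (s, t(0 := 2 * t 0 - 0)))) x = (k \<circ> (\<lambda>(s, t). (s, t(0 := 2 * t 0 - 1)))) x"
      unfolding st o_apply case_prod_conv by metis
  qed
  moreover have "H (s, t) = spheroid_concat (\<lambda>t. h (s, t)) (\<lambda>t. k (s, t)) t" for s t
    by (simp add: H_def spheroid_concat_def)
  moreover have "spheroid_concat (\<lambda>t. h (s, t)) (\<lambda>t. k (s, t)) t = a"
    if "s \<in> {0..1}" "t \<in> cube_boundary n" for s t
    using rescale_in_boundary[OF n that(2)] h(4) k(4) that(1) by (simp add: spheroid_concat_def)
  moreover have "spheroid_concat (\<lambda>t. h (0, t)) (\<lambda>t. k (0, t)) t = spheroid_concat f g t"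
    "spheroid_concat (\<lambda>t. h (1, t)) (\<lambda>t. k (1, t)) t = spheroid_concat f' g' t"
    if "t \<in> topspace (cube n)" for t
    using rescale_in_cube[OF n that] h(2,3) k(2,3) by (simp_all add: spheroid_concat_def)
  ultimately show ?thesis
    unfolding homotopic_spheroids_iff by (intro exI[of _ H]) simp
qed

lemma spheroid_concat: "n \<ge> 1 \<Longrightarrow> spheroid n X a f \<Longrightarrow> spheroid n X a g \<Longrightarrow> spheroid n X a (spheroid_concat f g)"
  unfolding homotopic_spheroids_refl[symmetric] by (rule homotopic_spheroids_concat)

definition spheroid_class :: "nat \<Rightarrow> 'a topology \<Rightarrow> 'a \<Rightarrow> ((nat \<Rightarrow> real) \<Rightarrow> 'a) \<Rightarrow> ((nat \<Rightarrow> real) \<Rightarrow> 'a) set" where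
  "spheroid_class n X a f = {g. homotopic_spheroids n X a f g}"

lemma spheroid_class_eq_iff:
  assumes "spheroid n X a f" "spheroid n X a g"
  shows "spheroid_class n X a f = spheroid_class n X a g \<longleftrightarrow> homotopic_spheroids n X a f g"
proof
  assume "spheroid_class n X a f = spheroid_class n X a g"
  then show "homotopic_spheroids n X a f g"
    using assms(2) unfolding spheroid_class_def homotopic_spheroids_refl[symmetric] by blast
next
  assume fg: "homotopic_spheroids n X a f g"
  have "homotopic_spheroids n X a f h \<longleftrightarrow> homotopic_spheroids n X a g h" for h
    using homotopic_spheroids_trans[OF fg] homotopic_spheroids_trans[OF homotopic_spheroids_sym[OF fg]]
    by blast
  then show "spheroid_class n X a f = spheroid_class n X a g"
    by (simp add: spheroid_class_def)
qed

lemma carrier_homotopy_group: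
  "carrier (homotopy_group n X a) = spheroid_class n X a ` Collect (spheroid n X a)"
  by (auto simp: homotopy_group_def quotient_def spheroid_class_def)

lemma mult_homotopy_group:
  assumes n: "n \<ge> 1" and f: "spheroid n X a f" and g: "spheroid n X a g"
  shows "spheroid_class n X a f \<otimes>\<^bsub>homotopy_group n X a\<^esub> spheroid_class n X a g =
    spheroid_class n X a (spheroid_concat f g)"
proof -
  have "homotopic_spheroids n X a (spheroid_concat f g) h"
    if "homotopic_spheroids n X a f f'" "homotopic_spheroids n X a g g'"
      "homotopic_spheroids n X a (spheroid_concat f' g') h" for f' g' h
    by (rule homotopic_spheroids_trans[OF homotopic_spheroids_concat[OF n that(1,2)] that(3)])
  then show ?thesis
    using f g unfolding homotopy_group_def spheroid_class_def homotopic_spheroids_refl[symmetric]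
    by auto
qed

text \<open>
  A complete invariant of spheroids up to homotopy that turns concatenation into multiplication
  induces an isomorphism.
\<close>

lemma homotopy_group_isoI:
  fixes \<Phi> :: "((nat \<Rightarrow> real) \<Rightarrow> 'a) \<Rightarrow> 'b"
  assumes n: "n \<ge> 1"
    and carrier: "\<And>f. spheroid n X a f \<Longrightarrow> \<Phi> f \<in> carrier G"
    and eq: "\<And>f g. spheroid n X a f \<Longrightarrow> spheroid n X a g \<Longrightarrow> homotopic_spheroids n X a f g \<longleftrightarrow> \<Phi> f = \<Phi> g"
    and mult: "\<And>f g. spheroid n X a f \<Longrightarrow> spheroid n X a g \<Longrightarrow> \<Phi> (spheroid_concat f g) = \<Phi> f \<otimes>\<^bsub>G\<^esub> \<Phi> g"
    and surj: "\<And>x. x \<in> carrier G \<Longrightarrow> \<exists>f. spheroid n X a f \<and> \<Phi> f = x"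
  shows "homotopy_group n X a \<cong> G"
proof -
  define h where "h P = \<Phi> (SOME f. f \<in> P)" for P
  have h: "h (spheroid_class n X a f) = \<Phi> f" if f: "spheroid n X a f" for f
  proof -
    have "(SOME g. g \<in> spheroid_class n X a f) \<in> spheroid_class n X a f"
      by (rule someI[of _ f]) (use f in \<open>simp add: spheroid_class_def homotopic_spheroids_refl\<close>)
    then have hom: "homotopic_spheroids n X a f (SOME g. g \<in> spheroid_class n X a f)"
      by (simp add: spheroid_class_def)
    then show ?thesis
      using eq[OF f] homotopic_spheroids_imp_spheroid[OF hom] by (simp add: h_def)
  qed
  have "h \<in> hom (homotopy_group n X a) G"
    by (rule homI)
      (auto simp: carrier_homotopy_group h carrier mult_homotopy_group[OF n] spheroid_concat[OF n] mult)
  moreover have "inj_on h (carrier (homotopy_group n X a))"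
    by (auto simp: inj_on_def carrier_homotopy_group h eq spheroid_class_eq_iff)
  moreover have "h ` carrier (homotopy_group n X a) = carrier G"
  proof
    show "h ` carrier (homotopy_group n X a) \<subseteq> carrier G"
      by (auto simp: carrier_homotopy_group h carrier)
    show "carrier G \<subseteq> h ` carrier (homotopy_group n X a)"
    proof
      fix x assume "x \<in> carrier G"
      then obtain f where "spheroid n X a f" "\<Phi> f = x" using surj by blast
      then show "x \<in> h ` carrier (homotopy_group n X a)"
        unfolding carrier_homotopy_group image_image using h by force
    qed
  qed
  ultimately have "h \<in> iso (homotopy_group n X a) G"
    by (simp add: iso_def bij_betw_def)
  then show ?thesis by (rule is_isoI)
qed

text \<open>
  The inverse of a bijective homomorphism preserves products because products of spheroid
  classes are again spheroid classes.
\<close>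

lemma homotopy_group_iso_sym:
  assumes n: "n \<ge> 1" and iso: "homotopy_group n X a \<cong> G"
  shows "G \<cong> homotopy_group n X a"
proof -
  let ?H = "homotopy_group n X a"
  obtain h where h: "h \<in> hom ?H G" "bij_betw h (carrier ?H) (carrier G)"
    using iso by (auto simp: is_iso_def iso_def)
  let ?g = "inv_into (carrier ?H) h"
  have closed: "x \<otimes>\<^bsub>?H\<^esub> y \<in> carrier ?H" if "x \<in> carrier ?H" "y \<in> carrier ?H" for x y
    using that by (auto simp: carrier_homotopy_group mult_homotopy_group[OF n] intro!: imageI spheroid_concat[OF n])
  have bij: "bij_betw ?g (carrier G) (carrier ?H)"
    by (rule bij_betw_inv_into[OF h(2)])
  have "?g \<in> hom G ?H"
  proof (rule homI)
    show "?g x \<in> carrier ?H" if "x \<in> carrier G" for x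
      using bij that by (auto simp: bij_betw_def)
    fix x y assume xy: "x \<in> carrier G" "y \<in> carrier G"
    then have g: "?g x \<in> carrier ?H" "?g y \<in> carrier ?H" "h (?g x) = x" "h (?g y) = y"
      using bij bij_betw_inv_into_right[OF h(2)] by (auto simp: bij_betw_def)
    then have "h (?g x \<otimes>\<^bsub>?H\<^esub> ?g y) = x \<otimes>\<^bsub>G\<^esub> y"
      using hom_mult[OF h(1)] by simp
    then show "?g (x \<otimes>\<^bsub>G\<^esub> y) = ?g x \<otimes>\<^bsub>?H\<^esub> ?g y"
      using bij_betw_inv_into_left[OF h(2) closed[OF g(1,2)]] by simp
  qed
  then show ?thesis
    using bij unfolding is_iso_def iso_def by blast
qed

lemma spheroid_compose:
  assumes "continuous_map X Y r" "spheroid n X a f"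
  shows "spheroid n Y (r a) (r \<circ> f)"
  using assms by (auto simp: spheroid_def intro: continuous_map_compose)

lemma homotopic_spheroids_compose:
  assumes "continuous_map X Y r" "homotopic_spheroids n X a f g"
  shows "homotopic_spheroids n Y (r a) (r \<circ> f) (r \<circ> g)"
  using assms(2) unfolding homotopic_spheroids_def
  by (rule homotopic_with_compose_continuous_map_left[OF _ assms(1)]) auto

lemma spheroid_concat_compose: "r \<circ> spheroid_concat f g = spheroid_concat (r \<circ> f) (r \<circ> g)"
  by (auto simp: spheroid_concat_def fun_eq_iff)

text \<open>
  For a base point in the space this says that the homotopy group is trivial.
\<close>

definition trivial_spheroids :: "nat \<Rightarrow> 'a topology \<Rightarrow> 'a \<Rightarrow> bool" where
  "trivial_spheroids n X a \<longleftrightarrow> (\<forall>f g. spheroid n X a f \<longrightarrow> spheroid n X a g \<longrightarrow> homotopic_spheroids n X a f g)"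

lemma homotopic_spheroids_pair:
  assumes "homotopic_spheroids n Y (fst c) f f'" "homotopic_spheroids n Z (snd c) g g'"
  shows "homotopic_spheroids n (prod_topology Y Z) c (\<lambda>t. (f t, g t)) (\<lambda>t. (f' t, g' t))"
proof -
  obtain h where "continuous_map (prod_topology (top_of_set {0..1::real}) (cube n)) Y h" "\<forall>t\<in>topspace (cube n). h (0, t) = f t"
    "\<forall>t\<in>topspace (cube n). h (1, t) = f' t" "\<forall>s\<in>{0..1}. \<forall>t\<in>cube_boundary n. h (s, t) = fst c"
    using assms(1) unfolding homotopic_spheroids_iff by blast
  moreover obtain k where "continuous_map (prod_topology (top_of_set {0..1::real}) (cube n)) Z k" "\<forall>t\<in>topspace (cube n). k (0, t) = g t"
    "\<forall>t\<in>topspace (cube n). k (1, t) = g' t" "\<forall>s\<in>{0..1}. \<forall>t\<in>cube_boundary n. k (s, t) = snd c"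
    using assms(2) unfolding homotopic_spheroids_iff by blast
  ultimately show ?thesis
    unfolding homotopic_spheroids_iff
    by (intro exI[of _ "\<lambda>x. (h x, k x)"]) (simp add: continuous_map_paired)
qed

text \<open>
  A homotopy between the first components \<open>r \<circ> f\<close> and \<open>r \<circ> g\<close> is completed by one between the second
  components, which exists because the spheroids of \<open>Z\<close> are all homotopic, and \<open>\<Psi>\<close> carries the
  pair back to \<open>X\<close>. A spheroid of \<open>Y\<close> is lifted with a constant second component.
\<close>

lemma homotopy_group_trivial_factor:
  assumes n: "n \<ge> 1" and r: "continuous_map X Y r" and \<rho>: "continuous_map X Z \<rho>"
    and \<Psi>: "continuous_map (prod_topology Y Z) X \<Psi>"
    and inv: "\<And>x. x \<in> topspace X \<Longrightarrow> \<Psi> (r x, \<rho> x) = x"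
    and r\<Psi>: "\<And>y z. y \<in> topspace Y \<Longrightarrow> z \<in> topspace Z \<Longrightarrow> r (\<Psi> (y, z)) = y"
    and a: "a \<in> topspace X" and triv: "trivial_spheroids n Z (\<rho> a)"
  shows "homotopy_group n X a \<cong> homotopy_group n Y (r a)"
proof (rule homotopy_group_isoI[OF n, where \<Phi> = "\<lambda>f. spheroid_class n Y (r a) (r \<circ> f)"])
  fix f assume f: "spheroid n X a f"
  then have rf: "spheroid n Y (r a) (r \<circ> f)" by (rule spheroid_compose[OF r])
  then show "spheroid_class n Y (r a) (r \<circ> f) \<in> carrier (homotopy_group n Y (r a))"
    by (auto simp: carrier_homotopy_group)
  fix g assume g: "spheroid n X a g"
  then have rg: "spheroid n Y (r a) (r \<circ> g)" by (rule spheroid_compose[OF r])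
  show "spheroid_class n Y (r a) (r \<circ> spheroid_concat f g) =
      spheroid_class n Y (r a) (r \<circ> f) \<otimes>\<^bsub>homotopy_group n Y (r a)\<^esub> spheroid_class n Y (r a) (r \<circ> g)"
    by (simp add: spheroid_concat_compose mult_homotopy_group[OF n rf rg])
  show "homotopic_spheroids n X a f g \<longleftrightarrow> spheroid_class n Y (r a) (r \<circ> f) = spheroid_class n Y (r a) (r \<circ> g)"
    unfolding spheroid_class_eq_iff[OF rf rg]
  proof
    assume "homotopic_spheroids n Y (r a) (r \<circ> f) (r \<circ> g)"
    moreover have "homotopic_spheroids n Z (\<rho> a) (\<rho> \<circ> f) (\<rho> \<circ> g)"
      using triv spheroid_compose[OF \<rho> f] spheroid_compose[OF \<rho> g] by (simp add: trivial_spheroids_def)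
    ultimately have "homotopic_spheroids n (prod_topology Y Z) (r a, \<rho> a)
        (\<lambda>t. ((r \<circ> f) t, (\<rho> \<circ> f) t)) (\<lambda>t. ((r \<circ> g) t, (\<rho> \<circ> g) t))"
      by (intro homotopic_spheroids_pair) (simp_all only: fst_conv snd_conv)
    from homotopic_spheroids_compose[OF \<Psi> this]
    have 1: "homotopic_spheroids n X a (\<lambda>t. \<Psi> (r (f t), \<rho> (f t))) (\<lambda>t. \<Psi> (r (g t), \<rho> (g t)))"
      by (simp add: inv a o_def)
    have "homotopic_spheroids n X a f (\<lambda>t. \<Psi> (r (f t), \<rho> (f t)))"
      by (rule homotopic_spheroids_eq[OF f]) (simp add: inv spheroid_in_topspace[OF f])
    moreover have "homotopic_spheroids n X a g (\<lambda>t. \<Psi> (r (g t), \<rho> (g t)))"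
      by (rule homotopic_spheroids_eq[OF g]) (simp add: inv spheroid_in_topspace[OF g])
    ultimately show "homotopic_spheroids n X a f g"
      using 1 homotopic_spheroids_sym homotopic_spheroids_trans by metis
  qed (rule homotopic_spheroids_compose[OF r])
next
  fix x assume "x \<in> carrier (homotopy_group n Y (r a))"
  then obtain g where g: "spheroid n Y (r a) g" "x = spheroid_class n Y (r a) g"
    by (auto simp: carrier_homotopy_group)
  have \<rho>a: "\<rho> a \<in> topspace Z"
    using \<rho> a continuous_map_image_subset_topspace by blast
  have "spheroid n (prod_topology Y Z) (r a, \<rho> a) (\<lambda>t. (g t, \<rho> a))"
    using g(1) \<rho>a by (auto simp: spheroid_def continuous_map_paired)
  then have f: "spheroid n X a (\<lambda>t. \<Psi> (g t, \<rho> a))"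
    using spheroid_compose[OF \<Psi>] by (fastforce simp: inv[OF a] o_def)
  moreover have "homotopic_spheroids n Y (r a) g (r \<circ> (\<lambda>t. \<Psi> (g t, \<rho> a)))"
  proof (rule homotopic_spheroids_eq[OF g(1)])
    fix t assume "t \<in> topspace (cube n)"
    then have "g t \<in> topspace Y"
      by (rule spheroid_in_topspace[OF g(1)])
    then show "g t = (r \<circ> (\<lambda>t. \<Psi> (g t, \<rho> a))) t" by (simp add: r\<Psi> \<rho>a)
  qed
  ultimately show "\<exists>f. spheroid n X a f \<and> spheroid_class n Y (r a) (r \<circ> f) = x"
    using g spheroid_class_eq_iff[OF g(1) spheroid_compose[OF r f]]
    by (intro exI[of _ "\<lambda>t. \<Psi> (g t, \<rho> a)"]) simp
qed

lemma homotopy_group_prod: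
  assumes n: "n \<ge> 1"
  shows "homotopy_group n (prod_topology X Y) (a, b) \<cong> homotopy_group n X a \<times>\<times> homotopy_group n Y b"
proof (rule homotopy_group_isoI[OF n,
      where \<Phi> = "\<lambda>f. (spheroid_class n X a (fst \<circ> f), spheroid_class n Y b (snd \<circ> f))"])
  let ?XY = "prod_topology X Y"
  have s1: "spheroid n X a (fst \<circ> f)" and s2: "spheroid n Y b (snd \<circ> f)" if "spheroid n ?XY (a, b) f" for f
    using spheroid_compose[OF continuous_map_fst that] spheroid_compose[OF continuous_map_snd that] by simp_all
  fix f assume f: "spheroid n ?XY (a, b) f"
  then show "(spheroid_class n X a (fst \<circ> f), spheroid_class n Y b (snd \<circ> f)) \<in> carrier (homotopy_group n X a \<times>\<times> homotopy_group n Y b)"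
    using s1 s2 by (auto simp: carrier_homotopy_group)
  fix g assume g: "spheroid n ?XY (a, b) g"
  show "(spheroid_class n X a (fst \<circ> spheroid_concat f g), spheroid_class n Y b (snd \<circ> spheroid_concat f g)) =
      (spheroid_class n X a (fst \<circ> f), spheroid_class n Y b (snd \<circ> f))
      \<otimes>\<^bsub>homotopy_group n X a \<times>\<times> homotopy_group n Y b\<^esub>
      (spheroid_class n X a (fst \<circ> g), spheroid_class n Y b (snd \<circ> g))"
    by (simp add: spheroid_concat_compose mult_homotopy_group[OF n] s1 s2 f g)
  show "homotopic_spheroids n ?XY (a, b) f g \<longleftrightarrow>
      (spheroid_class n X a (fst \<circ> f), spheroid_class n Y b (snd \<circ> f)) =
      (spheroid_class n X a (fst \<circ> g), spheroid_class n Y b (snd \<circ> g))"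
    unfolding prod.inject spheroid_class_eq_iff[OF s1[OF f] s1[OF g]] spheroid_class_eq_iff[OF s2[OF f] s2[OF g]]
  proof
    assume "homotopic_spheroids n ?XY (a, b) f g"
    then show "homotopic_spheroids n X a (fst \<circ> f) (fst \<circ> g) \<and> homotopic_spheroids n Y b (snd \<circ> f) (snd \<circ> g)"
      using homotopic_spheroids_compose[OF continuous_map_fst, of n X Y "(a, b)"]
        homotopic_spheroids_compose[OF continuous_map_snd, of n X Y "(a, b)"] by simp
  next
    assume "homotopic_spheroids n X a (fst \<circ> f) (fst \<circ> g) \<and> homotopic_spheroids n Y b (snd \<circ> f) (snd \<circ> g)"
    then show "homotopic_spheroids n ?XY (a, b) f g"
      using homotopic_spheroids_pair[of n X "(a, b)" "fst \<circ> f" "fst \<circ> g" Y "snd \<circ> f" "snd \<circ> g"] by simp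
  qed
next
  fix x assume "x \<in> carrier (homotopy_group n X a \<times>\<times> homotopy_group n Y b)"
  then obtain f g where fg: "spheroid n X a f" "spheroid n Y b g" "x = (spheroid_class n X a f, spheroid_class n Y b g)"
    by (auto simp: carrier_homotopy_group)
  then show "\<exists>f. spheroid n (prod_topology X Y) (a, b) f \<and> (spheroid_class n X a (fst \<circ> f), spheroid_class n Y b (snd \<circ> f)) = x"
    by (intro exI[of _ "\<lambda>t. (f t, g t)"]) (auto simp: spheroid_def continuous_map_paired o_def)
qed

section \<open>Homotopy groups of the punctured plane\<close>

text \<open>
  Two logarithms of the same number are equal or at distance at least \<open>2 \<pi>\<close>, so a continuous
  choice of them on a connected set does not jump.
\<close>

lemma exp_lift_constant:
  fixes h :: "'a::topological_space \<Rightarrow> complex"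
  assumes S: "connected S" and h: "continuous_on S h" and c: "\<And>x. x \<in> S \<Longrightarrow> exp (h x) = c"
  shows "h constant_on S"
proof (rule continuous_discrete_range_constant[OF S h])
  fix x assume x: "x \<in> S"
  have "2 * pi \<le> norm (h y - h x)" if y: "y \<in> S" "h y \<noteq> h x" for y
  proof (rule ccontr)
    assume "\<not> 2 * pi \<le> norm (h y - h x)"
    then have "\<bar>Im (h y) - Im (h x)\<bar> < 2 * pi"
      using abs_Im_le_cmod[of "h y - h x"] by simp
    then have "h y = h x"
    proof (rule exp_complex_eqI)
      show "exp (h y) = exp (h x)" by (simp only: c[OF x] c[OF y(1)])
    qed
    then show False using y(2) by simp
  qed
  then show "\<exists>e>0. \<forall>y. y \<in> S \<and> h y \<noteq> h x \<longrightarrow> e \<le> norm (h y - h x)"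
    by (intro exI[of _ "2 * pi"]) auto
qed

text \<open>
  The point of the one-dimensional cube with coordinate \<open>s\<close>; composition with \<open>edge\<close> turns
  spheroids into loops parametrised by the unit interval.
\<close>

definition edge :: "real \<Rightarrow> nat \<Rightarrow> real" where
  "edge s = (\<lambda>i\<in>{..<1}. s)"

lemma edge_0 [simp]: "edge s 0 = s"
  by (simp add: edge_def)

lemma edge_in_cube: "s \<in> {0..1} \<Longrightarrow> edge s \<in> topspace (cube 1)"
  by (simp add: topspace_cube edge_def)

lemma edge_eq: "t \<in> topspace (cube 1) \<Longrightarrow> edge (t 0) = t"
  by (auto simp: topspace_cube edge_def PiE_iff extensional_def fun_eq_iff)

lemma cube_1_coordinate: "t \<in> topspace (cube 1) \<Longrightarrow> t 0 \<in> {0..1}"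
  by (auto simp: topspace_cube PiE_iff)

lemma cube_boundary_1: "cube_boundary (Suc 0) = {edge 0, edge 1}"
  unfolding One_nat_def[symmetric]
proof
  show "cube_boundary 1 \<subseteq> {edge 0, edge 1}"
  proof
    fix t assume "t \<in> cube_boundary 1"
    then have "t \<in> topspace (cube 1)" "t 0 = 0 \<or> t 0 = 1"
      by (auto simp: cube_boundary_def)
    then show "t \<in> {edge 0, edge 1}" using edge_eq[of t] by auto
  qed
  show "{edge 0, edge 1} \<subseteq> cube_boundary 1"
    using edge_in_cube[of 0] edge_in_cube[of 1] by (auto simp: cube_boundary_def)
qed

lemma continuous_on_edge: "continuous_on S f \<Longrightarrow> continuous_on S (\<lambda>x. edge (f x))"
proof (rule continuous_on_coordinatewise_then_product)
  fix i :: nat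
  assume "continuous_on S f"
  then show "continuous_on S (\<lambda>x. edge (f x) i)"
    by (cases "i = 0") (simp_all add: edge_def)
qed

lemma continuous_on_coordinate: "continuous_on S f \<Longrightarrow> continuous_on S (\<lambda>x. (f x) i)"
  by (rule continuous_on_product_then_coordinatewise)

lemma continuous_map_cube_iff:
  "continuous_map (cube n) (top_of_set S) f \<longleftrightarrow> continuous_on (topspace (cube n)) f \<and> f ` topspace (cube n) \<subseteq> S"
  by (subst cube_eq_top_of_set) (auto simp: continuous_map_in_subtopology)

lemma continuous_map_homotopy_iff:
  "continuous_map (prod_topology (top_of_set {0..1::real}) (cube n)) (top_of_set S) h \<longleftrightarrow>
    continuous_on ({0..1} \<times> topspace (cube n)) h \<and> h ` ({0..1} \<times> topspace (cube n)) \<subseteq> S"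
  by (subst cube_eq_top_of_set) (auto simp: continuous_map_in_subtopology)

lemma spheroid_1_imp_loop:
  assumes "spheroid 1 (top_of_set S) a f"
  shows "path (f \<circ> edge)" "path_image (f \<circ> edge) \<subseteq> S" "pathstart (f \<circ> edge) = a" "pathfinish (f \<circ> edge) = a"
proof -
  have f: "continuous_on (topspace (cube 1)) f" "f ` topspace (cube 1) \<subseteq> S" "f (edge 0) = a" "f (edge 1) = a"
    using assms by (auto simp: spheroid_def continuous_map_cube_iff cube_boundary_1)
  have "continuous_on {0..1} (\<lambda>s. f (edge s))"
    by (rule continuous_on_compose2[OF f(1) continuous_on_edge[OF continuous_on_id]])
      (use edge_in_cube in auto)
  then show "path (f \<circ> edge)" by (simp add: path_def o_def)
  show "path_image (f \<circ> edge) \<subseteq> S"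
    using f(2) edge_in_cube by (auto simp: path_image_def)
  show "pathstart (f \<circ> edge) = a" "pathfinish (f \<circ> edge) = a"
    using f by (simp_all add: pathstart_def pathfinish_def)
qed

lemma loop_imp_spheroid_1:
  assumes "path p" "path_image p \<subseteq> S" "pathstart p = a" "pathfinish p = a"
  shows "spheroid 1 (top_of_set S) a (\<lambda>t. p (t 0))"
proof -
  have "continuous_on (topspace (cube 1)) (\<lambda>t. p (t 0))"
    by (rule continuous_on_compose2[OF assms(1)[unfolded path_def] continuous_on_coordinate[OF continuous_on_id]])
      (use cube_1_coordinate in auto)
  then show ?thesis
    using assms cube_1_coordinate
    by (auto simp: spheroid_def continuous_map_cube_iff cube_boundary_1 path_image_def pathstart_def pathfinish_def)
qed

lemma homotopic_spheroids_1_iff: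
  fixes S :: "'a::topological_space set"
  assumes f: "spheroid 1 (top_of_set S) a f" and g: "spheroid 1 (top_of_set S) a g"
  shows "homotopic_spheroids 1 (top_of_set S) a f g \<longleftrightarrow> homotopic_paths S (f \<circ> edge) (g \<circ> edge)"
proof
  assume "homotopic_spheroids 1 (top_of_set S) a f g"
  then obtain h :: "real \<times> (nat \<Rightarrow> real) \<Rightarrow> 'a"
    where h: "continuous_on ({0..1} \<times> topspace (cube 1)) h" "h ` ({0..1} \<times> topspace (cube 1)) \<subseteq> S"
    "\<forall>t\<in>topspace (cube 1). h (0, t) = f t" "\<forall>t\<in>topspace (cube 1). h (1, t) = g t"
    "\<forall>s\<in>{0..1}. \<forall>t\<in>cube_boundary 1. h (s, t) = a"
    unfolding homotopic_spheroids_iff continuous_map_homotopy_iff by blast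
  have "continuous_on ({0..1} \<times> {0..1}) (\<lambda>x. h (fst x, edge (snd x)))"
  proof (rule continuous_on_compose2[OF h(1)])
    show "continuous_on ({0..1} \<times> {0..1::real}) (\<lambda>x. (fst x :: real, edge (snd x)))"
      by (intro continuous_on_Pair continuous_on_edge continuous_on_fst continuous_on_snd continuous_on_id)
  qed (use edge_in_cube in auto)
  then show "homotopic_paths S (f \<circ> edge) (g \<circ> edge)"
    unfolding homotopic_paths
    using h edge_in_cube spheroid_1_imp_loop[OF f]
    by (intro exI[of _ "\<lambda>x. h (fst x, edge (snd x))"])
      (auto simp: pathstart_def pathfinish_def cube_boundary_1 image_subset_iff)
next
  assume "homotopic_paths S (f \<circ> edge) (g \<circ> edge)"
  then obtain k :: "real \<times> real \<Rightarrow> 'a" where k: "continuous_on ({0..1} \<times> {0..1}) k" "k \<in> ({0..1} \<times> {0..1}) \<rightarrow> S"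
    "\<forall>x\<in>{0..1}. k (0, x) = f (edge x)" "\<forall>x\<in>{0..1}. k (1, x) = g (edge x)"
    "\<forall>s\<in>{0..1}. k (s, 0) = f (edge 0) \<and> k (s, 1) = f (edge 1)"
    unfolding homotopic_paths pathstart_def pathfinish_def o_def by blast
  have "continuous_on ({0..1} \<times> topspace (cube 1)) (\<lambda>x. k (fst x, snd x 0))"
  proof (rule continuous_on_compose2[OF k(1)])
    show "continuous_on ({0..1} \<times> topspace (cube 1)) (\<lambda>x. (fst x, snd x 0))"
      by (intro continuous_on_Pair continuous_on_fst continuous_on_id
          continuous_on_coordinate[OF continuous_on_snd[OF continuous_on_id]])
  qed (use cube_1_coordinate in auto)
  moreover have "f (edge 0) = a" "f (edge 1) = a"
    using spheroid_1_imp_loop(3,4)[OF f] by (simp_all add: pathstart_def pathfinish_def)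
  ultimately show "homotopic_spheroids 1 (top_of_set S) a f g"
    unfolding homotopic_spheroids_iff continuous_map_homotopy_iff
    using k(2-5) cube_1_coordinate edge_eq
    by (intro exI[of _ "\<lambda>x. k (fst x, snd x 0)"]) (auto simp: cube_boundary_1)
qed

lemma spheroid_concat_edge: "spheroid_concat f g \<circ> edge = (f \<circ> edge) +++ (g \<circ> edge)"
proof
  fix s
  have "(edge s)(0 := 2 * s) = edge (2 * s)" "(edge s)(0 := 2 * s - 1) = edge (2 * s - 1)"
    by (auto simp: edge_def restrict_def fun_eq_iff)
  then show "(spheroid_concat f g \<circ> edge) s = ((f \<circ> edge) +++ (g \<circ> edge)) s"
    by (simp add: spheroid_concat_def joinpaths_def)
qed

lemma trivial_spheroids_simply_connected:
  fixes S :: "'a::real_normed_vector set"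
  assumes "simply_connected S"
  shows "trivial_spheroids 1 (top_of_set S) a"
  unfolding trivial_spheroids_def
proof (intro allI impI)
  fix f g assume f: "spheroid 1 (top_of_set S) a f" and g: "spheroid 1 (top_of_set S) a g"
  show "homotopic_spheroids 1 (top_of_set S) a f g"
    unfolding homotopic_spheroids_1_iff[OF f g]
    using assms spheroid_1_imp_loop[OF f] spheroid_1_imp_loop[OF g]
    unfolding simply_connected_eq_homotopic_paths by metis
qed

text \<open>
  The loop \<open>a exp(2 \<pi> \<i> m t)\<close> has \<open>2 \<pi> \<i> m t\<close> as a logarithm, up to a constant, and the
  winding number is the increase of any continuous logarithm divided by \<open>2 \<pi> \<i>\<close>.
\<close>

lemma exists_loop_with_winding_number:
  fixes m :: int
  assumes "a \<noteq> 0"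
  obtains p where "path p" "path_image p \<subseteq> - {0}" "pathstart p = a" "pathfinish p = a"
    "winding_number p 0 = of_int m"
proof -
  define p where "p t = a * exp (2 * of_real pi * \<i> * of_int m * of_real t)" for t
  have p: "path p"
    unfolding path_def p_def by (intro continuous_intros)
  have p0: "path_image p \<subseteq> - {0}"
    using assms by (auto simp: path_image_def p_def)
  have ends: "pathstart p = a" "pathfinish p = a"
    using exp_integer_2pi[of "of_int m"]
    by (simp_all add: pathstart_def pathfinish_def p_def mult.commute mult.left_commute)
  obtain q where q: "path q" "pathfinish q - pathstart q = 2 * of_real pi * \<i> * winding_number p 0"
    "\<And>t. t \<in> {0..1} \<Longrightarrow> p t = 0 + exp (q t)"
    using winding_number_as_continuous_log[OF p, of 0] p0 by auto
  define h where "h t = q t - 2 * of_real pi * \<i> * of_int m * of_real t" for t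
  have "h constant_on {0..1}"
  proof (rule exp_lift_constant)
    show "continuous_on {0..1} h"
      unfolding h_def using q(1) by (auto simp: path_def intro!: continuous_intros)
    show "exp (h t) = a" if "t \<in> {0..1}" for t
      using q(3)[OF that] by (simp add: h_def exp_diff p_def field_simps)
  qed simp
  then have "h 0 = h 1"
    by (auto simp: constant_on_def)
  then have "q 1 - q 0 = 2 * of_real pi * \<i> * of_int m"
    by (simp add: h_def algebra_simps)
  then have "winding_number p 0 = of_int m"
    using q(2) by (simp add: pathstart_def pathfinish_def)
  with p p0 ends show ?thesis by (rule that)
qed

text \<open>
  The winding number is a complete homotopy invariant of loops in the punctured plane, is
  additive under concatenation and takes all integer values.
\<close>

theorem fundamental_group_punctured_plane:
  fixes a :: complex
  assumes a: "a \<noteq> 0"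
  shows "homotopy_group 1 (top_of_set (- {0})) a \<cong> integer_group"
proof (rule homotopy_group_isoI[where \<Phi> = "\<lambda>f. \<lfloor>Re (winding_number (f \<circ> edge) 0)\<rfloor>"])
  let ?X = "top_of_set (- {0 :: complex})"
  let ?w = "\<lambda>f. winding_number (f \<circ> edge) 0"
  have int: "?w f = of_int \<lfloor>Re (?w f)\<rfloor>" if f: "spheroid 1 ?X a f" for f
  proof -
    have "?w f \<in> \<int>"
      using spheroid_1_imp_loop[OF f] by (intro integer_winding_number) auto
    then show ?thesis by (auto elim!: Ints_cases)
  qed
  have join: "?w (spheroid_concat f g) = ?w f + ?w g" if "spheroid 1 ?X a f" "spheroid 1 ?X a g" for f g
    unfolding spheroid_concat_edge
    using spheroid_1_imp_loop[OF that(1)] spheroid_1_imp_loop[OF that(2)]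
    by (intro winding_number_join) auto
  fix f assume f: "spheroid 1 ?X a f"
  fix g assume g: "spheroid 1 ?X a g"
  have "homotopic_spheroids 1 ?X a f g \<longleftrightarrow> ?w f = ?w g"
    unfolding homotopic_spheroids_1_iff[OF f g]
    using spheroid_1_imp_loop[OF f] spheroid_1_imp_loop[OF g]
    by (intro winding_number_homotopic_paths_eq[symmetric]) auto
  then show "homotopic_spheroids 1 ?X a f g \<longleftrightarrow> \<lfloor>Re (?w f)\<rfloor> = \<lfloor>Re (?w g)\<rfloor>"
    using int[OF f] int[OF g] by metis
  have "?w f + ?w g = of_int (\<lfloor>Re (?w f)\<rfloor> + \<lfloor>Re (?w g)\<rfloor>)"
    using int[OF f] int[OF g] by simp
  then have "Re (?w (spheroid_concat f g)) = of_int (\<lfloor>Re (?w f)\<rfloor> + \<lfloor>Re (?w g)\<rfloor>)"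
    unfolding join[OF f g] by (metis Re_complex_of_real of_real_of_int_eq)
  then show "\<lfloor>Re (?w (spheroid_concat f g))\<rfloor> = \<lfloor>Re (?w f)\<rfloor> \<otimes>\<^bsub>integer_group\<^esub> \<lfloor>Re (?w g)\<rfloor>"
    by (metis floor_of_int mult_integer_group)
next
  fix m :: int assume "m \<in> carrier integer_group"
  obtain p where "path p" "path_image p \<subseteq> - {0}" "pathstart p = a" "pathfinish p = a"
    and w: "winding_number p 0 = of_int m"
    by (rule exists_loop_with_winding_number[OF a])
  then have "spheroid 1 (top_of_set (- {0})) a (\<lambda>t. p (t 0))"
    by (intro loop_imp_spheroid_1)
  moreover have "(\<lambda>t. p (t 0)) \<circ> edge = p" by (simp add: fun_eq_iff)
  ultimately show "\<exists>f. spheroid 1 (top_of_set (- {0})) a f \<and> \<lfloor>Re (winding_number (f \<circ> edge) 0)\<rfloor> = m"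
    using w by (intro exI[of _ "\<lambda>t. p (t 0)"]) simp
qed simp_all

lemma compact_cube: "compact (topspace (cube n))"
proof -
  have interval: "compact_space (top_of_set {0..1::real})"
    by (rule compact_space_subtopology) (simp add: compactin_euclidean_iff)
  have "compact_space (cube n)"
    unfolding cube_def compact_space_product_topology using interval by blast
  then have "compactin (top_of_set (topspace (cube n))) (topspace (cube n))"
    unfolding compact_space_def using cube_eq_top_of_set[of n] by metis
  then show ?thesis
    unfolding compactin_subtopology compactin_euclidean_iff by blast
qed

definition shrink :: "nat \<Rightarrow> real \<Rightarrow> (nat \<Rightarrow> real) \<Rightarrow> nat \<Rightarrow> real" where
  "shrink n s t = (\<lambda>i\<in>{..<n}. s * t i)"

lemma shrink_in_cube: "s \<in> {0..1} \<Longrightarrow> t \<in> topspace (cube n) \<Longrightarrow> shrink n s t \<in> topspace (cube n)"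
  by (auto simp: topspace_cube shrink_def PiE_iff mult_le_one)

lemma shrink_1: "t \<in> topspace (cube n) \<Longrightarrow> shrink n 1 t = t"
  by (auto simp: topspace_cube shrink_def PiE_iff extensional_def fun_eq_iff)

lemma shrink_0: "shrink n 0 t = shrink n 0 t'"
  by (simp add: shrink_def)

lemma continuous_on_shrink:
  fixes f :: "'a::topological_space \<Rightarrow> real"
  assumes "continuous_on S f" "continuous_on S g"
  shows "continuous_on S (\<lambda>x. shrink n (f x) (g x))"
proof (rule continuous_on_coordinatewise_then_product)
  fix i
  have "continuous_on S (\<lambda>x. f x * g x i)"
    by (rule continuous_on_mult[OF assms(1) continuous_on_coordinate[OF assms(2)]])
  then show "continuous_on S (\<lambda>x. shrink n (f x) (g x) i)"
    by (cases "i < n") (simp_all add: shrink_def)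
qed

text \<open>
  Shrinking the cube to its corner \<open>0\<close> joins \<open>f\<close> to a constant. By uniform continuity the
  homotopy can be cut into finitely many stages such that the quotient of consecutive stages
  stays in the disc of radius \<open>1\<close> about \<open>1\<close>. There the principal logarithm is continuous, and
  the logarithms of the quotients add up to a logarithm of \<open>f\<close>.
\<close>

lemma continuous_log_on_cube:
  fixes f :: "(nat \<Rightarrow> real) \<Rightarrow> complex"
  assumes f: "continuous_on (topspace (cube n)) f" and nz: "\<And>t. t \<in> topspace (cube n) \<Longrightarrow> f t \<noteq> 0"
  obtains g where "continuous_on (topspace (cube n)) g" "\<And>t. t \<in> topspace (cube n) \<Longrightarrow> f t = exp (g t)"
proof -
  let ?C = "topspace (cube n)"
  define K where "K x = f (shrink n (fst x) (snd x))" for x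
  have K: "continuous_on ({0..1} \<times> ?C) K"
    unfolding K_def
    by (rule continuous_on_compose2[OF f continuous_on_shrink[OF continuous_on_fst continuous_on_snd]])
      (auto intro: continuous_on_id shrink_in_cube)
  have Knz: "K x \<noteq> 0" if "x \<in> {0..1} \<times> ?C" for x
    using that by (auto simp: K_def intro!: nz shrink_in_cube)
  have comp: "compact ({0..1::real} \<times> ?C)"
    by (intro compact_Times compact_cube) simp
  have "0 \<notin> K ` ({0..1} \<times> ?C)" "closed (K ` ({0..1} \<times> ?C))"
    using Knz compact_continuous_image[OF K comp] compact_imp_closed by auto
  then obtain m where m: "m > 0" "\<And>x. x \<in> {0..1} \<times> ?C \<Longrightarrow> m \<le> norm (K x)"
    using separate_point_closed[of "K ` ({0..1} \<times> ?C)" 0] by (auto simp: dist_norm)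
  have "uniformly_continuous_on ({0..1} \<times> ?C) K"
    by (rule compact_uniformly_continuous[OF K comp])
  then obtain d where d: "d > 0" "\<And>x y. x \<in> {0..1} \<times> ?C \<Longrightarrow> y \<in> {0..1} \<times> ?C \<Longrightarrow> dist y x < d \<Longrightarrow> dist (K y) (K x) < m"
    unfolding uniformly_continuous_on_def using m(1) by metis
  obtain N :: nat where N: "N > 0" "1 / real N < d"
    using d(1) by (metis nat_approx_posE of_nat_0_less_iff zero_less_Suc)
  define s where "s i = real i / real N" for i
  have s: "s i \<in> {0..1}" if "i \<le> N" for i
    using that N(1) by (simp add: s_def)
  have s_step: "s (Suc i) - s i = 1 / real N" for i
    by (simp add: s_def diff_divide_distrib[symmetric])
  define r where "r i t = K (s (Suc i), t) / K (s i, t)" for i t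
  have r: "r i t \<notin> \<real>\<^sub>\<le>\<^sub>0" "r i t \<noteq> 0" if "i < N" "t \<in> ?C" for i t
  proof -
    have in1: "(s (Suc i), t) \<in> {0..1} \<times> ?C" and in2: "(s i, t) \<in> {0..1} \<times> ?C"
      using that s by auto
    have "dist (s (Suc i), t) (s i, t) < d"
      using s_step[of i] N by (simp add: dist_Pair_Pair dist_real_def)
    then have "dist (K (s (Suc i), t)) (K (s i, t)) < norm (K (s i, t))"
      using d(2)[OF in2 in1] m(2)[OF in2] by simp
    moreover have "r i t - 1 = (K (s (Suc i), t) - K (s i, t)) / K (s i, t)"
      using Knz[OF in2] by (simp add: r_def field_simps)
    ultimately have "norm (r i t - 1) < 1"
      using Knz[OF in2] by (simp add: norm_divide dist_norm)
    then have "Re (r i t) > 0"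
      using abs_Re_le_cmod[of "r i t - 1"] by simp
    then show "r i t \<notin> \<real>\<^sub>\<le>\<^sub>0" "r i t \<noteq> 0"
      by (auto simp: complex_nonpos_Reals_iff)
  qed
  have K_cont: "continuous_on ?C (\<lambda>t. K (s i, t))" if "i \<le> N" for i
    by (rule continuous_on_compose2[OF K continuous_on_Pair[OF continuous_on_const continuous_on_id]])
      (use s[OF that] in auto)
  have r_cont: "continuous_on ?C (r i)" if "i < N" for i
    unfolding r_def using that s Knz
    by (intro continuous_on_divide K_cont) auto
  have K0: "K (s 0, t) = K (s 0, t')" for t t'
    using shrink_0[of n t t'] by (simp add: K_def s_def)
  define w0 where "w0 = K (s 0, \<lambda>i\<in>{..<n}. 0)"
  have "w0 \<noteq> 0"
    unfolding w0_def by (rule Knz) (auto simp: s_def topspace_cube)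
  define g where "g t = Ln w0 + (\<Sum>i<N. Ln (r i t))" for t
  have tele: "w0 * (\<Prod>i<j. r i t) = K (s j, t)" if "j \<le> N" "t \<in> ?C" for j t
    using that
  proof (induction j)
    case 0
    then show ?case using K0[of t "\<lambda>i\<in>{..<n}. 0"] by (simp add: w0_def)
  next
    case (Suc j)
    have "K (s j, t) \<noteq> 0" using Knz s[of j] Suc.prems by auto
    then show ?case using Suc by (simp add: r_def mult.assoc[symmetric])
  qed
  show ?thesis
  proof
    show "continuous_on ?C g"
      unfolding g_def
    proof (intro continuous_on_add continuous_on_const continuous_on_sum)
      fix i assume "i \<in> {..<N}"
      then show "continuous_on ?C (\<lambda>t. Ln (r i t))"
        by (intro continuous_on_Ln' r_cont r(1)) auto
    qed
    fix t assume t: "t \<in> ?C"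
    have "exp (g t) = w0 * (\<Prod>i<N. exp (Ln (r i t)))"
      using \<open>w0 \<noteq> 0\<close> by (simp add: g_def exp_add exp_sum)
    also have "\<dots> = w0 * (\<Prod>i<N. r i t)"
      using r(2)[OF _ t] by simp
    also have "\<dots> = f t"
      using tele[OF order_refl t] N(1) shrink_1[OF t] by (simp add: K_def s_def)
    finally show "f t = exp (g t)" by simp
  qed
qed

text \<open>
  A boundary point with \<open>t\<^sub>i \<in> {0, 1}\<close> can be moved to the corner \<open>z = 0\<close> inside the boundary: shrink
  all coordinates but \<open>t\<^sub>i\<close> to \<open>0\<close> along \<open>u\<close>, and then \<open>t\<^sub>i\<close> along \<open>v\<close>. During the second move another
  coordinate \<open>j\<close> is \<open>0\<close>, which is where \<open>n \<ge> 2\<close> enters.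
\<close>

lemma connected_cube_boundary:
  assumes n: "n \<ge> 2"
  shows "connected (cube_boundary n)"
proof -
  let ?C = "topspace (cube n)"
  have bd: "t \<in> cube_boundary n \<longleftrightarrow> t \<in> ?C \<and> (\<exists>i<n. t i = 0 \<or> t i = 1)" for t
    by (auto simp: cube_boundary_def)
  define z where "z = (\<lambda>i\<in>{..<n}. 0::real)"
  have z: "z \<in> cube_boundary n"
    using n unfolding bd by (auto simp: z_def topspace_cube intro!: exI[of _ 0])
  have "\<exists>T. connected T \<and> T \<subseteq> cube_boundary n \<and> t \<in> T \<and> z \<in> T" if t: "t \<in> cube_boundary n" for t
  proof -
    have tC: "t \<in> ?C" using t bd by blast
    obtain i where i: "i < n" "t i = 0 \<or> t i = 1" using t bd by blast
    define j where "j = (if i = 0 then 1 else 0 :: nat)"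
    have j: "j < n" "j \<noteq> i" using n by (auto simp: j_def)
    define u where "u s = (shrink n s t)(i := t i)" for s
    define v where "v s = z(i := s * t i)" for s
    have u_cont: "continuous_on {0..1} u"
    proof (rule continuous_on_coordinatewise_then_product)
      fix l
      have "continuous_on {0..1} (\<lambda>s. shrink n s t l)"
        by (rule continuous_on_coordinate[OF continuous_on_shrink[OF continuous_on_id continuous_on_const]])
      then show "continuous_on {0..1} (\<lambda>s. u s l)"
        by (cases "l = i") (auto simp: u_def)
    qed
    have v_cont: "continuous_on {0..1} v"
    proof (rule continuous_on_coordinatewise_then_product)
      fix l
      show "continuous_on {0..1} (\<lambda>s. v s l)"
        by (cases "l = i") (auto simp: v_def intro!: continuous_intros)
    qed
    have uC: "u s \<in> cube_boundary n" if "s \<in> {0..1}" for s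
    proof -
      have "u s \<in> ?C"
        using shrink_in_cube[OF that tC] tC i(1)
        by (auto simp: u_def topspace_cube PiE_iff extensional_def)
      moreover have "u s i = 0 \<or> u s i = 1" using i(2) by (simp add: u_def)
      ultimately show ?thesis using i(1) bd by blast
    qed
    have vC: "v s \<in> cube_boundary n" if "s \<in> {0..1}" for s
    proof -
      have "s * t i \<in> {0..1}" using that i(2) by auto
      then have "v s \<in> ?C"
        using i(1) by (auto simp: v_def z_def topspace_cube PiE_iff extensional_def)
      moreover have "v s j = 0" using j by (simp add: v_def z_def)
      ultimately show ?thesis using j(1) bd by blast
    qed
    have "u 1 = t" using shrink_1[OF tC] by (simp add: u_def)
    moreover have "u 0 = v 1" by (auto simp: u_def v_def shrink_def z_def restrict_def fun_eq_iff)
    moreover have "v 0 = z" using i(1) by (auto simp: v_def z_def fun_eq_iff)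
    moreover have "connected (u ` {0..1} \<union> v ` {0..1})"
      using \<open>u 0 = v 1\<close> by (intro connected_Un connected_continuous_image u_cont v_cont) force+
    ultimately show ?thesis
      using uC vC by (intro exI[of _ "u ` {0..1} \<union> v ` {0..1}"]) force
  qed
  then obtain T where T: "\<And>t. t \<in> cube_boundary n \<Longrightarrow> connected (T t) \<and> T t \<subseteq> cube_boundary n \<and> t \<in> T t \<and> z \<in> T t"
    by metis
  then have "cube_boundary n = (\<Union>t\<in>cube_boundary n. T t)" by blast
  moreover have "connected (\<Union>t\<in>cube_boundary n. T t)"
    using T by (intro connected_Union) auto
  ultimately show ?thesis by simp
qed

theorem trivial_spheroids_punctured_plane:
  assumes n: "n \<ge> 2"
  shows "trivial_spheroids n (top_of_set (- {0 :: complex})) a"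
proof -
  let ?X = "top_of_set (- {0 :: complex})" and ?C = "topspace (cube n)"
  have const: "homotopic_spheroids n ?X a f (\<lambda>_. a)" if f: "spheroid n ?X a f" for f
  proof -
    have f': "continuous_on ?C f" "\<And>t. t \<in> ?C \<Longrightarrow> f t \<noteq> 0" "\<And>t. t \<in> cube_boundary n \<Longrightarrow> f t = a"
      using f by (auto simp: spheroid_def continuous_map_cube_iff)
    obtain g where g: "continuous_on ?C g" "\<And>t. t \<in> ?C \<Longrightarrow> f t = exp (g t)"
      using continuous_log_on_cube[OF f'(1,2)] by blast
    have "g constant_on cube_boundary n"
    proof (rule exp_lift_constant)
      show "continuous_on (cube_boundary n) g"
        by (rule continuous_on_subset[OF g(1) cube_boundary_subset])
      show "exp (g t) = a" if "t \<in> cube_boundary n" for t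
        using g(2) f'(3) that cube_boundary_subset by (metis subsetD)
    qed (rule connected_cube_boundary[OF n])
    then obtain c where c: "\<And>t. t \<in> cube_boundary n \<Longrightarrow> g t = c"
      unfolding constant_on_def by blast
    have "(\<lambda>i\<in>{..<n}. 0) \<in> cube_boundary n"
      using n by (auto simp: cube_boundary_def topspace_cube intro!: exI[of _ 0])
    then have a: "a = exp c"
      using c g(2) f'(3) cube_boundary_subset by (metis subsetD)
    have "continuous_on ({0..1} \<times> ?C) (\<lambda>x. g (snd x))"
      by (rule continuous_on_compose2[OF g(1) continuous_on_snd[OF continuous_on_id]]) auto
    then have "continuous_on ({0..1} \<times> ?C) (\<lambda>x. exp (of_real (1 - fst x) * g (snd x) + of_real (fst x) * c))"
      by (intro continuous_intros)
    then show ?thesis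
      unfolding homotopic_spheroids_iff continuous_map_homotopy_iff
      by (intro exI[of _ "\<lambda>x. exp (of_real (1 - fst x) * g (snd x) + of_real (fst x) * c)"])
        (auto simp: g(2) c a algebra_simps)
  qed
  show ?thesis
    unfolding trivial_spheroids_def
    by (intro allI impI homotopic_spheroids_trans[OF const homotopic_spheroids_sym[OF const]])
qed

section \<open>The space of nondegenerate hypermatrices\<close>

text \<open>
  The orbit map identifies \<open>GL\<^sub>k \<times> GL\<^sub>k\<^sub>+\<^sub>1\<close> with \<open>M\<^sub>k \<times> \<complex>\<^sup>*\<close>, and the second factor is invisible
  to \<open>\<pi>\<^sub>n\<close> for \<open>n \<ge> 2\<close>. Using the orbit of \<open>a0\<close> instead of \<open>a\<close> matches the given base points: the
  pair \<open>(b, c)\<close> sends \<open>a0\<close> to \<open>a\<close>.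
\<close>

lemma pi_n_nondegenerate:
  fixes a :: "complex^'k^'m^2" and b :: "complex^'k^'k" and c :: "complex^'m^'m"
  assumes card: "CARD('m) = CARD('k) + 1" and n: "n \<ge> 2" and a: "a \<in> nondegenerate_hypermatrices"
    and b: "b \<in> general_linear" and c: "c \<in> general_linear"
  shows "homotopy_group n (top_of_set nondegenerate_hypermatrices) a \<cong>
    homotopy_group n (top_of_set general_linear) b \<times>\<times> homotopy_group n (top_of_set general_linear) c"
proof -
  let ?M = "nondegenerate_hypermatrices :: (complex^'k^'m^2) set"
  let ?G = "general_linear \<times> general_linear :: ((complex^'k^'k) \<times> (complex^'m^'m)) set"
  have n1: "n \<ge> 1" using n by simp
  obtain bI where bI: "b ** bI = mat 1" "bI ** b = mat 1"
    using b by (auto simp: general_linear_def invertible_def)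
  obtain cI where cI: "c ** cI = mat 1" "cI ** c = mat 1"
    using c by (auto simp: general_linear_def invertible_def)
  define a0 where "a0 = act cI a bI"
  have a0: "a0 \<in> ?M"
    unfolding a0_def using a bI cI by (intro act_nondegenerate[OF card]) (auto simp: invertible_def)
  have act_a0: "act c a0 b = a"
    by (simp add: a0_def act_act bI cI)
  obtain g where g: "homeomorphism ?G (?M \<times> - {0}) (orbit_map a0) g"
    using orbit_map_homeomorphism[OF card a0] .
  have cont: "continuous_on ?G (orbit_map a0)" and img: "orbit_map a0 ` ?G = ?M \<times> - {0}"
    and cont_g: "continuous_on (?M \<times> - {0}) g" and img_g: "g ` (?M \<times> - {0}) = ?G"
    and inv: "\<And>x. x \<in> ?G \<Longrightarrow> g (orbit_map a0 x) = x" "\<And>y. y \<in> ?M \<times> - {0} \<Longrightarrow> orbit_map a0 (g y) = y"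
    using g unfolding homeomorphism_def by auto
  have "homotopy_group n (top_of_set ?G) (b, c) \<cong> homotopy_group n (top_of_set ?M) ((fst \<circ> orbit_map a0) (b, c))"
  proof (rule homotopy_group_trivial_factor[OF n1])
    have "continuous_on ?G (fst \<circ> orbit_map a0)" "continuous_on ?G (snd \<circ> orbit_map a0)"
      unfolding o_def by (intro continuous_on_fst continuous_on_snd cont)+
    moreover have "orbit_map a0 x \<in> ?M \<times> - {0}" if "x \<in> ?G" for x
      using img that by blast
    then have "(fst \<circ> orbit_map a0) x \<in> ?M" "(snd \<circ> orbit_map a0) x \<in> - {0}" if "x \<in> ?G" for x
      using that unfolding o_apply mem_Times_iff by blast+
    ultimately show "continuous_map (top_of_set ?G) (top_of_set ?M) (fst \<circ> orbit_map a0)"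
      "continuous_map (top_of_set ?G) (top_of_set (- {0})) (snd \<circ> orbit_map a0)"
      by (simp_all only: continuous_map_in_subtopology continuous_map_iff_continuous topspace_euclidean_subtopology Pi_iff)
        blast+
    show "continuous_map (prod_topology (top_of_set ?M) (top_of_set (- {0}))) (top_of_set ?G) g"
      using cont_g img_g by (auto simp: continuous_map_in_subtopology)
    show "(b, c) \<in> topspace (top_of_set ?G)" using b c by simp
    show "trivial_spheroids n (top_of_set (- {0})) ((snd \<circ> orbit_map a0) (b, c))"
      by (rule trivial_spheroids_punctured_plane[OF n])
  qed (use inv in simp_all)
  moreover have "(fst \<circ> orbit_map a0) (b, c) = a"
    by (simp add: orbit_map_def act_a0)
  ultimately have "homotopy_group n (top_of_set ?M) a \<cong> homotopy_group n (top_of_set ?G) (b, c)"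
    using homotopy_group_iso_sym[OF n1] by (metis (no_types))
  moreover have "homotopy_group n (top_of_set ?G) (b, c) \<cong>
      homotopy_group n (top_of_set general_linear) b \<times>\<times> homotopy_group n (top_of_set general_linear) c"
    using homotopy_group_prod[OF n1, of "top_of_set general_linear" "top_of_set general_linear" b c] by simp
  ultimately show ?thesis by (rule iso_trans)
qed

text \<open>
  A nondegenerate \<open>x\<close> is obtained from \<open>a\<close> by the action of a unique pair \<open>s x = (A, B)\<close> with
  \<open>det A det B = 1\<close>. Let \<open>r\<close> record \<open>det A\<close>, and \<open>\<rho>\<close> the matrices \<open>A\<close> and \<open>B\<close> with one row divided
  by the determinant. Then \<open>\<Psi>\<close> restores the determinants and lets the pair act on \<open>a\<close>.
\<close>

lemma nondegenerate_decomposition: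
  fixes a :: "complex^'k^'m^2"
  assumes card: "CARD('m) = CARD('k) + 1" and a: "a \<in> nondegenerate_hypermatrices"
  obtains r :: "complex^'k^'m^2 \<Rightarrow> complex" and \<rho> :: "complex^'k^'m^2 \<Rightarrow> (complex^'k^'k) \<times> (complex^'m^'m)" and \<Psi>
  where "continuous_on nondegenerate_hypermatrices r" "r ` nondegenerate_hypermatrices \<subseteq> - {0}"
    and "continuous_on nondegenerate_hypermatrices \<rho>"
      "\<rho> ` nondegenerate_hypermatrices \<subseteq> special_linear \<times> special_linear"
    and "continuous_on ((- {0}) \<times> (special_linear \<times> special_linear)) \<Psi>"
      "\<Psi> ` ((- {0}) \<times> (special_linear \<times> special_linear)) \<subseteq> nondegenerate_hypermatrices"
    and "\<forall>x\<in>nondegenerate_hypermatrices. \<Psi> (r x, \<rho> x) = x"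
    and "\<forall>d\<in>- {0}. \<forall>z\<in>special_linear \<times> special_linear. r (\<Psi> (d, z)) = d"
proof -
  let ?M = "nondegenerate_hypermatrices :: (complex^'k^'m^2) set"
  let ?G = "general_linear \<times> general_linear :: ((complex^'k^'k) \<times> (complex^'m^'m)) set"
  let ?S = "special_linear \<times> special_linear :: ((complex^'k^'k) \<times> (complex^'m^'m)) set"
  obtain g where g: "homeomorphism ?G (?M \<times> - {0}) (orbit_map a) g"
    using orbit_map_homeomorphism[OF card a] .
  have cont_g: "continuous_on (?M \<times> - {0}) g" and img_g: "g ` (?M \<times> - {0}) = ?G"
    and inv: "\<And>x. x \<in> ?G \<Longrightarrow> g (orbit_map a x) = x" "\<And>y. y \<in> ?M \<times> - {0} \<Longrightarrow> orbit_map a (g y) = y"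
    using g unfolding homeomorphism_def by auto
  define s where "s x = g (x, 1)" for x
  have s_cont: "continuous_on ?M s"
    unfolding s_def
    by (rule continuous_on_compose2[OF cont_g continuous_on_Pair[OF continuous_on_id continuous_on_const]]) auto
  have s: "det (fst (s x)) * det (snd (s x)) = 1" "act (snd (s x)) a (fst (s x)) = x" if "x \<in> ?M" for x
    using inv(2)[of "(x, 1)"] that by (simp_all add: s_def orbit_map_def case_prod_beta)
  have s_nz: "det (fst (s x)) \<noteq> 0" "det (snd (s x)) \<noteq> 0" if "x \<in> ?M" for x
    using s(1)[OF that] by auto
  have s_act: "s (act B a A) = (A, B)" if "det A * det B = 1" for A B
  proof -
    have "(A, B) \<in> ?G" using that by (auto simp: general_linear_def invertible_det_nz)
    from inv(1)[OF this] show ?thesis by (simp add: s_def orbit_map_def that)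
  qed
  obtain i :: 'k and j :: 'm where True by simp
  define r where "r x = det (fst (s x))" for x
  define \<rho> where "\<rho> x = (normalise_row i (fst (s x)), normalise_row j (snd (s x)))" for x
  define \<Psi> where "\<Psi> = (\<lambda>(d, z). act (scale_row j (1 / d) (snd z)) a (scale_row i d (fst z)))"
  show ?thesis
  proof (rule that)
    show "continuous_on ?M r"
      unfolding r_def by (intro continuous_on_det continuous_on_fst s_cont)
    show "r ` ?M \<subseteq> - {0}" using s_nz by (auto simp: r_def)
    show "continuous_on ?M \<rho>"
      unfolding \<rho>_def
      by (intro continuous_on_Pair continuous_on_normalise_row continuous_on_fst continuous_on_snd s_cont s_nz)
    show "\<rho> ` ?M \<subseteq> ?S"
      using s_nz by (auto simp: \<rho>_def special_linear_def det_normalise_row)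
    show "continuous_on ((- {0}) \<times> ?S) \<Psi>"
      unfolding \<Psi>_def case_prod_beta
      by (intro continuous_on_act continuous_on_scale_row continuous_on_divide continuous_on_const
          continuous_on_fst continuous_on_snd continuous_on_id) auto
    show "\<Psi> ` ((- {0}) \<times> ?S) \<subseteq> ?M"
    proof (rule image_subsetI)
      fix x :: "complex \<times> (complex^'k^'k) \<times> (complex^'m^'m)"
      assume "x \<in> (- {0}) \<times> ?S"
      then obtain d P Q where "x = (d, P, Q)" "d \<noteq> 0" "P \<in> special_linear" "Q \<in> special_linear"
        by auto
      then show "\<Psi> x \<in> ?M"
        using a by (auto simp: \<Psi>_def invertible_det_nz det_scale_row special_linear_def
            intro!: act_nondegenerate[OF card])
    qed
    show "\<forall>x\<in>?M. \<Psi> (r x, \<rho> x) = x"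
    proof
      fix x assume x: "x \<in> ?M"
      have "1 / det (fst (s x)) * (1 / det (snd (s x))) = 1"
        using s(1)[OF x] by (simp add: divide_simps)
      then show "\<Psi> (r x, \<rho> x) = x"
        using s(2)[OF x] s_nz[OF x] by (simp add: \<Psi>_def r_def \<rho>_def normalise_row_def)
    qed
    show "\<forall>d\<in>- {0}. \<forall>z\<in>?S. r (\<Psi> (d, z)) = d"
    proof (intro ballI)
      fix d z assume dz: "d \<in> - {0 :: complex}" "z \<in> ?S"
      have "s (\<Psi> (d, z)) = (scale_row i d (fst z), scale_row j (1 / d) (snd z))"
        unfolding \<Psi>_def case_prod_conv
        by (rule s_act) (use dz in \<open>auto simp: det_scale_row special_linear_def\<close>)
      then show "r (\<Psi> (d, z)) = d"
        using dz by (auto simp: r_def det_scale_row special_linear_def)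
    qed
  qed
qed

lemma simply_connected_SL_product:
  "simply_connected (special_linear \<times> special_linear :: ((complex^'k^'k) \<times> (complex^'m^'m)) set)"
  by (intro simply_connected_Times simply_connected_special_linear)

lemma connected_nondegenerate:
  assumes card: "CARD('m::finite) = CARD('k::finite) + 1"
  shows "connected (nondegenerate_hypermatrices :: (complex^'k^'m^2) set)"
proof -
  let ?M = "nondegenerate_hypermatrices :: (complex^'k^'m^2) set"
  let ?S = "special_linear \<times> special_linear :: ((complex^'k^'k) \<times> (complex^'m^'m)) set"
  obtain a where a: "a \<in> ?M" using nondegenerate_nonempty[OF card] by blast
  obtain r :: "complex^'k^'m^2 \<Rightarrow> complex" and \<rho> :: "complex^'k^'m^2 \<Rightarrow> (complex^'k^'k) \<times> (complex^'m^'m)" and \<Psi>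
    where r: "continuous_on ?M r" "r ` ?M \<subseteq> - {0}"
      and \<rho>: "continuous_on ?M \<rho>" "\<rho> ` ?M \<subseteq> ?S"
      and \<Psi>: "continuous_on ((- {0}) \<times> ?S) \<Psi>" "\<Psi> ` ((- {0}) \<times> ?S) \<subseteq> ?M"
      and inv: "\<forall>x\<in>?M. \<Psi> (r x, \<rho> x) = x" "\<forall>d\<in>- {0}. \<forall>z\<in>?S. r (\<Psi> (d, z)) = d"
    using nondegenerate_decomposition[OF card a] .
  have "x \<in> \<Psi> ` ((- {0}) \<times> ?S)" if x: "x \<in> ?M" for x
  proof -
    have "(r x, \<rho> x) \<in> (- {0}) \<times> ?S" using x r(2) \<rho>(2) by blast
    then show ?thesis using inv(1) x by (metis imageI)
  qed
  then have "\<Psi> ` ((- {0}) \<times> ?S) = ?M" using \<Psi>(2) by blast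
  moreover have "connected ((- {0 :: complex}) \<times> ?S)"
    by (intro connected_Times connected_punctured_universe simply_connected_imp_connected simply_connected_SL_product) simp
  ultimately show ?thesis
    using connected_continuous_image[OF \<Psi>(1)] by simp
qed

lemma pi_1_nondegenerate:
  fixes a :: "complex^'k^'m^2"
  assumes card: "CARD('m) = CARD('k) + 1" and a: "a \<in> nondegenerate_hypermatrices"
  shows "homotopy_group 1 (top_of_set nondegenerate_hypermatrices) a \<cong> integer_group"
proof -
  let ?M = "nondegenerate_hypermatrices :: (complex^'k^'m^2) set"
  let ?S = "special_linear \<times> special_linear :: ((complex^'k^'k) \<times> (complex^'m^'m)) set"
  obtain r :: "complex^'k^'m^2 \<Rightarrow> complex" and \<rho> :: "complex^'k^'m^2 \<Rightarrow> (complex^'k^'k) \<times> (complex^'m^'m)" and \<Psi>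
    where r: "continuous_on ?M r" "r ` ?M \<subseteq> - {0}"
      and \<rho>: "continuous_on ?M \<rho>" "\<rho> ` ?M \<subseteq> ?S"
      and \<Psi>: "continuous_on ((- {0}) \<times> ?S) \<Psi>" "\<Psi> ` ((- {0}) \<times> ?S) \<subseteq> ?M"
      and inv: "\<forall>x\<in>?M. \<Psi> (r x, \<rho> x) = x" "\<forall>d\<in>- {0}. \<forall>z\<in>?S. r (\<Psi> (d, z)) = d"
    using nondegenerate_decomposition[OF card a] .
  have "homotopy_group 1 (top_of_set ?M) a \<cong> homotopy_group 1 (top_of_set (- {0})) (r a)"
  proof (rule homotopy_group_trivial_factor)
    show "continuous_map (top_of_set ?M) (top_of_set (- {0})) r"
      using r by (auto simp: continuous_map_in_subtopology)
    show "continuous_map (top_of_set ?M) (top_of_set ?S) \<rho>"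
      using \<rho> by (auto simp: continuous_map_in_subtopology)
    show "continuous_map (prod_topology (top_of_set (- {0})) (top_of_set ?S)) (top_of_set ?M) \<Psi>"
      using \<Psi> by (auto simp: continuous_map_in_subtopology)
    show "trivial_spheroids 1 (top_of_set ?S) (\<rho> a)"
      by (rule trivial_spheroids_simply_connected[OF simply_connected_SL_product])
  qed (use inv a in auto)
  moreover have "r a \<noteq> 0" using r(2) a by auto
  ultimately show ?thesis
    using fundamental_group_punctured_plane iso_trans by blast
qed

theorem corollary3p3:
  fixes M :: "(complex^'k::finite^'m::finite^2) set"
    and GLk :: "(complex^'k^'k) set"
    and GLk1 :: "(complex^'m^'m) set"
  assumes "CARD('m) = CARD('k) + 1"
    and "M = nondegenerate_hypermatrices"
    and "GLk = general_linear"
    and "GLk1 = general_linear"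
  shows "M \<noteq> {} \<and> connected M \<and>
    (\<forall>a\<in>M. homotopy_group 1 (top_of_set M) a \<cong> integer_group) \<and>
    (\<forall>n\<ge>2. \<forall>a\<in>M. \<forall>b\<in>GLk. \<forall>c\<in>GLk1.
       homotopy_group n (top_of_set M) a \<cong>
         homotopy_group n (top_of_set GLk) b \<times>\<times> homotopy_group n (top_of_set GLk1) c)"
  unfolding assms(2-4)
  using nondegenerate_nonempty[OF assms(1)] connected_nondegenerate[OF assms(1)]
    pi_1_nondegenerate[OF assms(1)] pi_n_nondegenerate[OF assms(1)]
  by blast

end
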